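(* Fix an integer $m\geq1$. For nonnegative integers $r_1,\ldots,r_m$ let $D(r_1,\ldots,r_m)$ be the number of acyclic orientations of the complete multipartite graph having $r_j$ parts of size $j$, for $1\leq j\leq m$. Put $$N=\sum_{j=1}^mjr_j,\qquad A_j=-\frac{j(j-1)}2,\qquad B_j=\frac{j(j-1)(j-2)(3j-5)}{24},\qquad E_j=B_j-\frac{A_j^2}{2},$$ $$\mu_1=\frac1N\sum_{j=1}^mr_jA_j,\qquad \mu_2=\frac1N\sum_{j=1}^mr_jE_j.$$ Then, uniformly for all nonnegative integers $r_1,\ldots,r_m$ with $\sum_jjr_j=N\to\infty$, $$D(r_1,\ldots,r_m)=e^{\mu_1}N!\left(1+\frac{\mu_2+\mu_1^2/2}{N}+O(N^{-2})\right),$$ where the implicit constant in $O(N^{-2})$ may depend on $m$ but not on the vector $(r_1,\ldots,r_m)$.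
   Context: All notation is introduced in the claim. *)

theory Defs
  imports Complex_Main
begin

(* A finite simple graph is given by its set of edges, each edge a two-element set of vertices. *)

definition complete_multipartite_edges :: "'a set set \<Rightarrow> 'a set set" where
  "complete_multipartite_edges P =
     {{u, v} | u v X Y. X \<in> P \<and> Y \<in> P \<and> X \<noteq> Y \<and> u \<in> X \<and> v \<in> Y}"

definition is_orientation :: "'a set set \<Rightarrow> ('a \<times> 'a) set \<Rightarrow> bool" where
  "is_orientation E R \<longleftrightarrow>
     (\<forall>u v. (u, v) \<in> R \<longrightarrow> {u, v} \<in> E) \<and>
     (\<forall>u v. {u, v} \<in> E \<longrightarrow> ((u, v) \<in> R \<longleftrightarrow> (v, u) \<notin> R))"

definition acyclic_orientations :: "'a set set \<Rightarrow> ('a \<times> 'a) set set" where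
  "acyclic_orientations E = {R. is_orientation E R \<and> acyclic R}"

(* The vertex (j, i, k) is the k-th vertex of the i-th part of size j. *)

definition part :: "nat \<Rightarrow> nat \<Rightarrow> (nat \<times> nat \<times> nat) set" where
  "part j i = {(j, i, k) | k. k < j}"

definition parts :: "nat \<Rightarrow> (nat \<Rightarrow> nat) \<Rightarrow> (nat \<times> nat \<times> nat) set set" where
  "parts m r = {part j i | j i. 1 \<le> j \<and> j \<le> m \<and> i < r j}"

definition num_acyclic :: "nat \<Rightarrow> (nat \<Rightarrow> nat) \<Rightarrow> nat" where
  "num_acyclic m r = card (acyclic_orientations (complete_multipartite_edges (parts m r)))"

definition num_vertices :: "nat \<Rightarrow> (nat \<Rightarrow> nat) \<Rightarrow> nat" where
  "num_vertices m r = (\<Sum>j = 1..m. j * r j)"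

definition coef_A :: "nat \<Rightarrow> real" where
  "coef_A j = - (real j * (real j - 1) / 2)"

definition coef_B :: "nat \<Rightarrow> real" where
  "coef_B j = real j * (real j - 1) * (real j - 2) * (3 * real j - 5) / 24"

definition coef_E :: "nat \<Rightarrow> real" where
  "coef_E j = coef_B j - (coef_A j)\<^sup>2 / 2"

definition mu1 :: "nat \<Rightarrow> (nat \<Rightarrow> nat) \<Rightarrow> real" where
  "mu1 m r = 1 / real (num_vertices m r) * (\<Sum>j = 1..m. real (r j) * coef_A j)"

definition mu2 :: "nat \<Rightarrow> (nat \<Rightarrow> nat) \<Rightarrow> real" where
  "mu2 m r = 1 / real (num_vertices m r) * (\<Sum>j = 1..m. real (r j) * coef_E j)"

end

theory Submission
  imports Defs "HOL-Library.Disjoint_Sets" "HOL-Computational_Algebra.Polynomial_FPS"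
begin

text \<open>
  Inclusion-exclusion over the set of sources gives \<open>\<Sum>S. (-1)^|S| a(G - S) = 0\<close>, where \<open>S\<close> ranges over the
  independent sets of a nonempty graph \<open>G\<close> and \<open>a\<close> counts acyclic orientations. For complete multipartite
  graphs this recursion is solved by \<open>a = L(\<Prod>X. p_|X|)\<close>, where \<open>L(x^k) = k!\<close> and
  \<open>p_j(x) = \<Sum>k. S(j,k) (-1)^(j-k) x^k\<close>: the identity \<open>p_j' = - \<Sum>s\<ge>1. (-1)^s (j choose s) p_(j-s)\<close> turns it
  into \<open>L(P') = L(P) - P(0)\<close>.

  Reversing the polynomials, \<open>D / N! = \<Sum>k. c_k (N-k)! / N!\<close> where
  \<open>\<Sum>k. c_k y^k = exp (N \<mu>1 y) G(y)\<close> and \<open>G(y) = 1 + N \<mu>2 y^2 + \<dots>\<close>. The coefficients of \<open>G\<close> are majorised by those of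
  \<open>(exp (\<beta> y) - \<beta> y)^N\<close>, so after \<open>y \<mapsto> y / N\<close> those of degree at least 3 are \<open>O(N^-2)\<close> with a summable majorant.
  As the product has no terms of degree below \<open>N / m\<close>, the factors
  \<open>N^k (N-k)! / N! = 1 + k (k-1) / (2 N) + O(N^-2)\<close> grow at most exponentially in \<open>k\<close>, and summing over \<open>k\<close>
  gives \<open>exp \<mu>1 (1 + (\<mu>2 + \<mu>1^2 / 2) / N) + O(N^-2)\<close>.
\<close>

section \<open>Touchard polynomials and the functional sending \<open>x^k\<close> to
  \<open>k!\<close>\<close>

text \<open>The \<open>j\<close>-th polynomial is \<open>\<Sum>k. S(j,k) (-1)^(j-k) x^k\<close> with Stirling numbers of the second kind,
  that is, the Touchard polynomial at \<open>-x\<close> up to sign; its generating function is \<open>exp (x (1 - exp (-t)))\<close>.\<close>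

fun touchard :: "nat \<Rightarrow> real poly" where
  "touchard 0 = 1"
| "touchard (Suc j) = pCons 0 (touchard j - pderiv (touchard j))"

lemma pderiv_sum: "pderiv (\<Sum>i\<in>I. f i) = (\<Sum>i\<in>I. pderiv (f i))"
  by (induction I rule: infinite_finite_induct) (auto simp: pderiv_add)

text \<open>With F = exp (x (1 - exp (-t))) this is exp (-t) F = F - dF/dx, compared at
  \<open>t^j / j!\<close>. The induction uses Pascal's rule instead. Cancelling the term
  \<open>s = 0\<close> expresses the derivative through nonempty subsets, as the recursion over
  sources requires.\<close>

lemma touchard_binomial_transform:
  "(\<Sum>s\<le>j. smult (real (j choose s) * (-1) ^ s) (touchard (j - s))) = touchard j - pderiv (touchard j)"
proof (induction j)
  case 0
  then show ?case by simp
next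
  case (Suc j)
  define T where "T = (\<Sum>s\<le>j. smult (real (j choose s) * (-1) ^ s) (touchard (j - s)))"
  have pT: "pderiv T = (\<Sum>s\<le>j. smult (real (j choose s) * (-1) ^ s) (pderiv (touchard (j - s))))"
    unfolding T_def by (simp add: pderiv_sum pderiv_smult)
  have "(\<Sum>s\<le>Suc j. smult (real (Suc j choose s) * (-1) ^ s) (touchard (Suc j - s))) =
     touchard (Suc j) + (\<Sum>s\<le>j. smult (real (Suc j choose Suc s) * (-1) ^ Suc s) (touchard (j - s)))"
    by (subst sum.atMost_Suc_shift) simp
  also have "(\<Sum>s\<le>j. smult (real (Suc j choose Suc s) * (-1) ^ Suc s) (touchard (j - s))) =
     (\<Sum>s\<le>j. smult (real (j choose Suc s) * (-1) ^ Suc s) (touchard (j - s))) - T"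
  proof -
    have "smult (real (Suc j choose Suc s) * (-1) ^ Suc s) t =
        smult (real (j choose Suc s) * (-1) ^ Suc s) t - smult (real (j choose s) * (-1) ^ s) t" for s t
      unfolding smult_diff_left[symmetric] by (rule arg_cong2[where f = smult]) (simp_all add: algebra_simps)
    then show ?thesis unfolding T_def by (simp only: sum_subtractf)
  qed
  also have "touchard (Suc j) + ((\<Sum>s\<le>j. smult (real (j choose Suc s) * (-1) ^ Suc s) (touchard (j - s))) - T)
     = (\<Sum>s\<le>Suc j. smult (real (j choose s) * (-1) ^ s) (touchard (Suc j - s))) - T"
    by (subst sum.atMost_Suc_shift) simp
  \<comment> \<open>The term \<open>s = Suc j\<close> has binomial coefficient zero, so the defining
    recursion of \<open>touchard\<close> applies to all remaining terms.\<close>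
  also have "(\<Sum>s\<le>Suc j. smult (real (j choose s) * (-1) ^ s) (touchard (Suc j - s))) =
      (\<Sum>s\<le>j. smult (real (j choose s) * (-1) ^ s) (touchard (Suc (j - s))))"
    by (simp add: binomial_eq_0 Suc_diff_le)
  also have "\<dots> = [:0, 1:] * (T - pderiv T)"
    unfolding pT unfolding T_def by (simp add: sum_distrib_left sum_subtractf[symmetric] smult_diff_right[symmetric] algebra_simps)
  also have "[:0, 1:] * (T - pderiv T) - T = touchard (Suc j) - pderiv (touchard (Suc j))"
  proof -
    have *: "touchard (Suc j) = [:0, 1:] * T" using Suc by (simp add: T_def)
    show ?thesis unfolding * by (simp add: pderiv_mult pderiv_pCons algebra_simps)
  qed
  finally show ?case .
qed

lemma degree_touchard_lead: "degree (touchard j) = j \<and> lead_coeff (touchard j) = 1"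
proof (induction j)
  case (Suc j)
  let ?d = "touchard j - pderiv (touchard j)"
  have c: "coeff ?d j = 1"
    using Suc by (metis coeff_diff coeff_pderiv coeff_eq_0 lessI mult_zero_right diff_zero)
  have "degree ?d \<le> j"
    using Suc by (intro degree_diff_le) (auto simp: degree_pderiv)
  moreover have "degree ?d \<ge> j" using c by (intro le_degree) auto
  ultimately have "degree ?d = j" by simp
  then show ?case using c by (auto simp: degree_pCons_eq_if)
qed auto

lemma degree_touchard [simp]: "degree (touchard j) = j"
  and lead_coeff_touchard [simp]: "coeff (touchard j) j = 1"
  using degree_touchard_lead[of j] by auto

lemma touchard_nonzero [simp]: "touchard j \<noteq> 0"
  using lead_coeff_touchard[of j] by (metis coeff_0 zero_neq_one)

lemma coeff_touchard_0: "coeff (touchard j) 0 = (if j = 0 then 1 else 0)"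
  by (cases j) auto

text \<open>The integral of \<open>p x * exp (- x)\<close> over the positive half-line.\<close>

definition laplace_one :: "real poly \<Rightarrow> real" where
  "laplace_one p = (\<Sum>k\<le>degree p. coeff p k * fact k)"

lemma laplace_one_upto:
  assumes "degree p \<le> n" shows "laplace_one p = (\<Sum>k\<le>n. coeff p k * fact k)"
  unfolding laplace_one_def using assms by (intro sum.mono_neutral_left) (auto simp: coeff_eq_0)

lemma laplace_one_add: "laplace_one (p + q) = laplace_one p + laplace_one q"
  by (simp add: laplace_one_upto[of _ "max (degree p) (degree q)"] degree_add_le
      sum.distrib distrib_right)

lemma laplace_one_smult: "laplace_one (smult c p) = c * laplace_one p"
  by (simp add: laplace_one_upto[of _ "degree p"] degree_smult_le sum_distrib_left mult.assoc)

lemma laplace_one_1 [simp]: "laplace_one 1 = 1"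
  by (simp add: laplace_one_def)

lemma laplace_one_0 [simp]: "laplace_one 0 = 0"
  by (simp add: laplace_one_def)

lemma laplace_one_sum: "laplace_one (\<Sum>i\<in>I. f i) = (\<Sum>i\<in>I. laplace_one (f i))"
  by (induction I rule: infinite_finite_induct) (auto simp: laplace_one_add)

text \<open>Integration by parts against exp (-x), with boundary term p(0).\<close>

lemma laplace_one_pderiv: "laplace_one (pderiv p) = laplace_one p - coeff p 0"
proof -
  have "laplace_one p = (\<Sum>k\<le>Suc (degree p). coeff p k * fact k)"
    by (rule laplace_one_upto) simp
  also have "\<dots> = coeff p 0 + (\<Sum>k\<le>degree p. coeff p (Suc k) * fact (Suc k))"
    by (subst sum.atMost_Suc_shift) simp
  also have "(\<Sum>k\<le>degree p. coeff p (Suc k) * fact (Suc k)) = (\<Sum>k\<le>degree p. coeff (pderiv p) k * fact k)"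
    by (intro sum.cong) (auto simp: coeff_pderiv algebra_simps)
  also have "\<dots> = laplace_one (pderiv p)"
    by (rule laplace_one_upto[symmetric]) (simp add: degree_pderiv)
  finally show ?thesis by simp
qed

lemma sum_Pow_card:
  fixes f :: "nat \<Rightarrow> real"
  assumes "finite A"
  shows "(\<Sum>S\<in>Pow A. f (card S)) = (\<Sum>s\<le>card A. real (card A choose s) * f s)"
proof -
  have "(\<Sum>S\<in>Pow A. f (card S)) = (\<Sum>s\<le>card A. \<Sum>S | S \<in> Pow A \<and> card S = s. f (card S))"
    using assms by (intro sum.group[symmetric]) (auto intro: card_mono)
  also have "\<dots> = (\<Sum>s\<le>card A. real (card A choose s) * f s)"
    using assms by (intro sum.cong) (simp_all add: n_subsets)
  finally show ?thesis .
qed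

lemma sum_Pow_alternating:
  assumes "finite A" "A \<noteq> {}"
  shows "(\<Sum>S\<in>Pow A. (-1) ^ card S) = (0 :: real)"
  using sum_Pow_card[of A "\<lambda>s. (-1) ^ s"] choose_alternating_sum[of "card A", where ?'a = real] assms
  by (simp add: card_gt_0_iff mult.commute)

section \<open>Acyclic orientations of complete multipartite graphs\<close>

definition induced_edges :: "'a set set \<Rightarrow> 'a set \<Rightarrow> 'a set set" where
  "induced_edges E W = {e \<in> E. e \<subseteq> W}"

text \<open>The vertex set is passed explicitly because the arcs do not record isolated vertices,
  which count as sources.\<close>

definition sources :: "'a set \<Rightarrow> ('a \<times> 'a) set \<Rightarrow> 'a set" where
  "sources W R = {v \<in> W. \<forall>u. (u, v) \<notin> R}"

definition independent_set :: "'a set set \<Rightarrow> 'a set \<Rightarrow> bool" where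
  "independent_set E S \<longleftrightarrow> (\<forall>u\<in>S. \<forall>v\<in>S. {u, v} \<notin> E)"

lemma orientation_subset:
  "is_orientation (induced_edges E W) R \<Longrightarrow> R \<subseteq> W \<times> W"
  unfolding is_orientation_def induced_edges_def by fast

lemma orientation_edge: "is_orientation E R \<Longrightarrow> (u, v) \<in> R \<Longrightarrow> {u, v} \<in> E"
  and orientation_iff: "is_orientation E R \<Longrightarrow> {u, v} \<in> E \<Longrightarrow> (u, v) \<in> R \<longleftrightarrow> (v, u) \<notin> R"
  unfolding is_orientation_def by blast+

lemma finite_acyclic_orientations:
  "finite W \<Longrightarrow> finite (acyclic_orientations (induced_edges E W))"
  by (rule finite_subset[of _ "Pow (W \<times> W)"])
     (auto simp: acyclic_orientations_def dest: orientation_subset)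

text \<open>A finite acyclic relation is well-founded, and a minimal element of \<open>W\<close> is
  a source because all arcs stay inside \<open>W\<close>.\<close>

lemma sources_nonempty:
  assumes "finite W" "W \<noteq> {}" "R \<in> acyclic_orientations (induced_edges E W)"
  shows "sources W R \<noteq> {}"
proof -
  have sub: "R \<subseteq> W \<times> W" and ac: "acyclic R"
    using assms(3) by (auto simp: acyclic_orientations_def dest: orientation_subset)
  have "finite R" using sub assms(1) by (meson finite_SigmaI finite_subset)
  then have "wf R" using ac by (rule finite_acyclic_wf)
  then obtain z where "z \<in> W" "\<forall>y. (y, z) \<in> R \<longrightarrow> y \<notin> W"
    using assms(2) by (meson wfE_min ex_in_conv)
  then show ?thesis using sub by (auto simp: sources_def)
qed

text \<open>No arc ends in \<open>S\<close>, so a cycle has its base point outside \<open>S\<close>;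
  from there only arcs of \<open>R\<close> can be followed.\<close>

lemma acyclic_add_sources:
  assumes "acyclic R" "Range R' \<inter> S = {}" "Range R \<inter> S = {}" "Domain R' \<subseteq> S" "R \<subseteq> (- S) \<times> (- S)"
  shows "acyclic (R \<union> R')"
proof (rule acyclicI, intro allI notI)
  fix x assume x: "(x, x) \<in> (R \<union> R')\<^sup>+"
  have *: "(x, y) \<in> (R \<union> R')\<^sup>+ \<Longrightarrow> x \<notin> S \<Longrightarrow> (x, y) \<in> R\<^sup>+ \<and> y \<notin> S" for x y
  proof (induction rule: trancl_induct)
    case (base y)
    then show ?case using assms by auto
  next
    case (step y z)
    then show ?case using assms by (auto intro: trancl_into_trancl)
  qed
  have "x \<notin> S"
    using x tranclD2[OF x] assms by auto
  then show False using *[OF x] assms(1) by (auto simp: acyclic_def)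
qed

text \<open>Once all of \<open>S\<close> consists of sources, every edge at \<open>S\<close> must
  leave \<open>S\<close>. Adding these forced arcs \<open>R0\<close> is inverse to restricting to
  \<open>W - S\<close>.\<close>

lemma card_orientations_with_sources:
  assumes "S \<subseteq> W" and ind: "independent_set E S"
  shows "card {R \<in> acyclic_orientations (induced_edges E W). S \<subseteq> sources W R} =
    card (acyclic_orientations (induced_edges E (W - S)))"
proof -
  define R0 where "R0 = {(s, v). s \<in> S \<and> v \<in> W - S \<and> {s, v} \<in> E}"
  have nS: "{u, v} \<notin> E" if "u \<in> S" "v \<in> S" for u v
    using ind that by (auto simp: independent_set_def)
  let ?A = "acyclic_orientations (induced_edges E (W - S))"
  let ?B = "{R \<in> acyclic_orientations (induced_edges E W). S \<subseteq> sources W R}"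
  have "bij_betw (\<lambda>R. R \<union> R0) ?A ?B"
  proof (rule bij_betwI[where g = "\<lambda>R. R \<inter> (W - S) \<times> (W - S)"])
    show "(\<lambda>R. R \<union> R0) \<in> ?A \<rightarrow> ?B"
    proof
      fix R assume "R \<in> ?A"
      then have o: "is_orientation (induced_edges E (W - S)) R" and ac: "acyclic R"
        by (auto simp: acyclic_orientations_def)
      note sub = orientation_subset[OF o]
      have "acyclic (R \<union> R0)"
        using sub by (intro acyclic_add_sources[OF ac, where S = S]) (auto simp: R0_def)
      moreover have "is_orientation (induced_edges E W) (R \<union> R0)"
        unfolding is_orientation_def
      proof (intro conjI allI impI)
        fix u v assume "(u, v) \<in> R \<union> R0"
        then show "{u, v} \<in> induced_edges E W"
          using orientation_edge[OF o, of u v] \<open>S \<subseteq> W\<close> by (auto simp: R0_def induced_edges_def)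
      next
        fix u v assume e: "{u, v} \<in> induced_edges E W"
        then have W: "u \<in> W" "v \<in> W" "{u, v} \<in> E" "{v, u} \<in> E"
          by (auto simp: induced_edges_def insert_commute)
        consider "u \<in> S" "v \<notin> S" | "v \<in> S" "u \<notin> S" | "u \<notin> S" "v \<notin> S"
          using nS W by blast
        then show "(u, v) \<in> R \<union> R0 \<longleftrightarrow> (v, u) \<notin> R \<union> R0"
        proof cases
          case 3
          then have "{u, v} \<in> induced_edges E (W - S)" using e by (auto simp: induced_edges_def)
          then have "(u, v) \<in> R \<longleftrightarrow> (v, u) \<notin> R" by (rule orientation_iff[OF o])
          then show ?thesis using 3 by (auto simp: R0_def)
        qed (use W sub in \<open>auto simp: R0_def\<close>)
      qed
      moreover have "S \<subseteq> sources W (R \<union> R0)"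
        using \<open>S \<subseteq> W\<close> sub by (auto simp: sources_def R0_def)
      ultimately show "R \<union> R0 \<in> ?B" by (auto simp: acyclic_orientations_def)
    qed
    show "(\<lambda>R. R \<inter> (W - S) \<times> (W - S)) \<in> ?B \<rightarrow> ?A"
    proof
      fix R assume "R \<in> ?B"
      then have o: "is_orientation (induced_edges E W) R" and ac: "acyclic R"
        by (auto simp: acyclic_orientations_def)
      have "acyclic (R \<inter> (W - S) \<times> (W - S))"
        using ac by (rule acyclic_subset) auto
      moreover have "is_orientation (induced_edges E (W - S)) (R \<inter> (W - S) \<times> (W - S))"
        unfolding is_orientation_def
      proof (intro conjI allI impI)
        fix u v assume "(u, v) \<in> R \<inter> (W - S) \<times> (W - S)"
        then show "{u, v} \<in> induced_edges E (W - S)"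
          using orientation_edge[OF o, of u v] by (auto simp: induced_edges_def)
      next
        fix u v assume "{u, v} \<in> induced_edges E (W - S)"
        then have "u \<in> W - S" "v \<in> W - S" "{u, v} \<in> induced_edges E W"
          by (auto simp: induced_edges_def)
        then show "(u, v) \<in> R \<inter> (W - S) \<times> (W - S) \<longleftrightarrow> (v, u) \<notin> R \<inter> (W - S) \<times> (W - S)"
          using orientation_iff[OF o, of u v] by auto
      qed
      ultimately show "R \<inter> (W - S) \<times> (W - S) \<in> ?A" by (auto simp: acyclic_orientations_def)
    qed
    fix R assume "R \<in> ?A"
    then have "R \<subseteq> (W - S) \<times> (W - S)" 
      by (auto simp: acyclic_orientations_def dest: orientation_subset)
    then show "(R \<union> R0) \<inter> (W - S) \<times> (W - S) = R" by (auto simp: R0_def)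
  next
    fix R assume "R \<in> ?B"
    then have o: "is_orientation (induced_edges E W) R" and s: "S \<subseteq> sources W R"
      by (auto simp: acyclic_orientations_def)
    note sub = orientation_subset[OF o]
    have "(u, v) \<in> R \<longleftrightarrow> (u, v) \<in> R0" if "\<not> (u \<in> W - S \<and> v \<in> W - S)" for u v
    proof
      assume uv: "(u, v) \<in> R"
      then have "v \<notin> S" using s by (auto simp: sources_def)
      moreover have "{u, v} \<in> E" using orientation_edge[OF o uv] by (auto simp: induced_edges_def)
      ultimately show "(u, v) \<in> R0" using that sub uv by (auto simp: R0_def)
    next
      assume "(u, v) \<in> R0"
      then have uv: "u \<in> S" "v \<in> W" "{u, v} \<in> E" by (auto simp: R0_def)
      then have "{u, v} \<in> induced_edges E W" using \<open>S \<subseteq> W\<close> by (auto simp: induced_edges_def)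
      moreover have "(v, u) \<notin> R" using uv s by (auto simp: sources_def)
      ultimately show "(u, v) \<in> R" using orientation_iff[OF o] by blast
    qed
    then show "R \<inter> (W - S) \<times> (W - S) \<union> R0 = R" 
      by (auto simp: R0_def)
  qed
  then show ?thesis by (simp add: bij_betw_same_card)
qed

lemma sources_independent:
  assumes "R \<in> acyclic_orientations (induced_edges E W)"
  shows "independent_set E (sources W R)"
  unfolding independent_set_def
proof (intro ballI notI)
  fix u v assume uv: "u \<in> sources W R" "v \<in> sources W R" "{u, v} \<in> E"
  then have "{u, v} \<in> induced_edges E W" by (auto simp: sources_def induced_edges_def)
  then have "(u, v) \<in> R \<or> (v, u) \<in> R"
    using assms unfolding acyclic_orientations_def is_orientation_def by blast
  then show False using uv by (auto simp: sources_def)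
qed

text \<open>Double counting of pairs of an orientation and a set \<open>S\<close> of its sources.
  For a fixed orientation, \<open>S\<close> runs over all subsets of a nonempty set, so the signs
  cancel.\<close>

lemma acyclic_orientations_alternating_sum:
  assumes "finite W" "W \<noteq> {}"
  shows "(\<Sum>S | S \<subseteq> W \<and> independent_set E S.
            (-1) ^ card S * real (card (acyclic_orientations (induced_edges E (W - S))))) = 0"
proof -
  let ?O = "acyclic_orientations (induced_edges E W)"
  let ?I = "{S. S \<subseteq> W \<and> independent_set E S}"
  have finO: "finite ?O" using assms by (simp add: finite_acyclic_orientations)
  have finI: "finite ?I" using assms by (auto intro: finite_subset[of _ "Pow W"])
  have "(\<Sum>S\<in>?I. (-1) ^ card S * real (card (acyclic_orientations (induced_edges E (W - S))))) =
        (\<Sum>S\<in>?I. \<Sum>R | R \<in> ?O \<and> S \<subseteq> sources W R. (-1) ^ card S)"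
    using finO by (intro sum.cong refl) (simp add: card_orientations_with_sources[symmetric])
  also have "\<dots> = (\<Sum>R\<in>?O. \<Sum>S | S \<in> ?I \<and> S \<subseteq> sources W R. (-1) ^ card S)"
    by (rule sum.swap_restrict[OF finI finO])
  also have "\<dots> = (\<Sum>R\<in>?O. 0)"
  proof (rule sum.cong[OF refl])
    fix R assume R: "R \<in> ?O"
    \<comment> \<open>Subsets of the source set are automatically independent, so the restriction to
      \<open>?I\<close> costs nothing.\<close>
    have "{S. S \<in> ?I \<and> S \<subseteq> sources W R} = Pow (sources W R)"
      using sources_independent[OF R] by (auto simp: independent_set_def sources_def)
    moreover have "finite (sources W R)" using assms by (auto simp: sources_def)
    ultimately show "(\<Sum>S | S \<in> ?I \<and> S \<subseteq> sources W R. (-1) ^ card S) = (0 :: real)"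
      using sum_Pow_alternating sources_nonempty[OF assms R] by simp
  qed
  finally show ?thesis by simp
qed

text \<open>Two members of \<open>S\<close> from different parts would be adjacent. For
  \<open>S = {}\<close> and \<open>P = {}\<close> the right-hand side fails, hence the third
  assumption.\<close>

lemma independent_multipartite:
  assumes "disjoint P" "S \<subseteq> \<Union>P" "S \<noteq> {}"
  shows "independent_set (complete_multipartite_edges P) S \<longleftrightarrow> (\<exists>X\<in>P. S \<subseteq> X)"
proof
  assume i: "independent_set (complete_multipartite_edges P) S"
  obtain u X where u: "u \<in> S" "u \<in> X" "X \<in> P" using assms by blast
  have "S \<subseteq> X"
  proof
    fix v assume v: "v \<in> S"
    then obtain Y where Y: "v \<in> Y" "Y \<in> P" using assms by blast
    have "{u, v} \<notin> complete_multipartite_edges P" using i u v by (auto simp: independent_set_def)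
    then show "v \<in> X" using u Y unfolding complete_multipartite_edges_def by blast
  qed
  then show "\<exists>X\<in>P. S \<subseteq> X" using u by blast
next
  assume "\<exists>X\<in>P. S \<subseteq> X"
  then obtain X where X: "X \<in> P" "S \<subseteq> X" by blast
  have "Y = X" if "Y \<in> P" "u \<in> Y" "u \<in> X" for Y u
    using disjointD[OF assms(1) that(1) X(1)] that by blast
  then show "independent_set (complete_multipartite_edges P) S"
    using X unfolding independent_set_def complete_multipartite_edges_def
    by (auto simp: doubleton_eq_iff) (metis subsetD)+
qed

text \<open>The induction keeps \<open>P\<close> fixed and shrinks \<open>W\<close>, since deleting
  \<open>S\<close> leaves a set that need not be a union of parts; an exhausted part contributes
  \<open>touchard 0 = 1\<close>.\<close>

theorem card_acyclic_orientations_multipartite: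
  assumes P: "finite P" "disjoint P" and "finite W" "W \<subseteq> \<Union>P"
  shows "real (card (acyclic_orientations (induced_edges (complete_multipartite_edges P) W))) =
    laplace_one (\<Prod>X\<in>P. touchard (card (X \<inter> W)))"
  using assms(3,4)
proof (induction W rule: finite_psubset_induct)
  case (psubset W)
  let ?E = "complete_multipartite_edges P"
  let ?a = "\<lambda>W. real (card (acyclic_orientations (induced_edges ?E W)))"
  let ?F = "\<lambda>W. \<Prod>X\<in>P. touchard (card (X \<inter> W))"
  show ?case
  proof (cases "W = {}")
    case True
    have "acyclic_orientations (induced_edges ?E {}) = {{}}"
      by (auto simp: acyclic_orientations_def acyclic_def induced_edges_def is_orientation_def
          complete_multipartite_edges_def)
    then show ?thesis using True by simp
  next
    case False
    let ?I = "{S. S \<subseteq> W \<and> independent_set ?E S}"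
    \<comment> \<open>The empty set would lie in every part; it is split off so that the remaining
      independent sets belong to exactly one part.\<close>
    let ?J = "\<lambda>X. Pow (X \<inter> W) - {{}}"
    have "S \<in> ?I \<longleftrightarrow> S \<in> insert {} (\<Union>X\<in>P. ?J X)" for S
    proof (cases "S = {} \<or> \<not> S \<subseteq> W")
      case False
      then have "S \<subseteq> \<Union>P" "S \<noteq> {}" using psubset.prems by blast+
      from independent_multipartite[OF P(2) this] show ?thesis using False by auto
    qed (auto simp: independent_set_def)
    then have I: "?I = insert {} (\<Union>X\<in>P. ?J X)" by blast
    have finJ: "finite (?J X)" for X using psubset.hyps by simp
    have "0 = (\<Sum>S\<in>?I. (-1) ^ card S * ?a (W - S))"
      using acyclic_orientations_alternating_sum[OF psubset.hyps False]
      by simp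
    also have "\<dots> = ?a W + (\<Sum>S\<in>(\<Union>X\<in>P. ?J X). (-1) ^ card S * ?a (W - S))"
      unfolding I using finite_UN_I[OF P(1) finJ] by (subst sum.insert) auto
    also have "(\<Sum>S\<in>(\<Union>X\<in>P. ?J X). (-1) ^ card S * ?a (W - S)) =
        (\<Sum>X\<in>P. \<Sum>S\<in>?J X. (-1) ^ card S * ?a (W - S))"
    proof (rule sum.UNION_disjoint[OF P(1)])
      show "\<forall>X\<in>P. \<forall>Y\<in>P. X \<noteq> Y \<longrightarrow> ?J X \<inter> ?J Y = {}"
        using disjointD[OF P(2)] by blast
    qed (use finJ in auto)
    also have "\<dots> = (\<Sum>X\<in>P. - laplace_one (pderiv (touchard (card (X \<inter> W))) * (\<Prod>Y\<in>P - {X}. touchard (card (Y \<inter> W)))))"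
    proof (rule sum.cong[OF refl])
      fix X assume X: "X \<in> P"
      let ?n = "card (X \<inter> W)"
      let ?R = "\<Prod>Y\<in>P - {X}. touchard (card (Y \<inter> W))"
      have "?a (W - S) = laplace_one (touchard (?n - card S) * ?R)" if "S \<in> ?J X" for S
      proof -
        have "?a (W - S) = laplace_one (?F (W - S))"
          using that psubset.prems by (intro psubset.IH) auto
        also have "?F (W - S) = touchard (card (X \<inter> (W - S))) * (\<Prod>Y\<in>P - {X}. touchard (card (Y \<inter> (W - S))))"
          by (rule prod.remove[OF P(1) X])
        also have "(\<Prod>Y\<in>P - {X}. touchard (card (Y \<inter> (W - S)))) = ?R"
        proof (rule prod.cong[OF refl])
          fix Y assume "Y \<in> P - {X}"
          then have "Y \<inter> (W - S) = Y \<inter> W" using disjointD[OF P(2), of X Y] X that by auto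
          then show "touchard (card (Y \<inter> (W - S))) = touchard (card (Y \<inter> W))" by simp
        qed
        also have "card (X \<inter> (W - S)) = ?n - card S"
        proof -
          have "finite S" using that psubset.hyps by (auto intro: finite_subset)
          moreover have "X \<inter> (W - S) = X \<inter> W - S" by auto
          ultimately show ?thesis using that by (auto simp: card_Diff_subset)
        qed
        finally show ?thesis .
      qed
      then have "(\<Sum>S\<in>?J X. (-1) ^ card S * ?a (W - S)) =
          (\<Sum>S\<in>?J X. (-1) ^ card S * laplace_one (touchard (?n - card S) * ?R))"
        by simp
      \<comment> \<open>The empty subset is put back so that the full binomial transform can be
        applied.\<close>
      also have "\<dots> = (\<Sum>S\<in>Pow (X \<inter> W). (-1) ^ card S * laplace_one (touchard (?n - card S) * ?R)) -
          laplace_one (touchard ?n * ?R)"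
        using psubset.hyps by (subst sum_diff1) auto
      also have "(\<Sum>S\<in>Pow (X \<inter> W). (-1) ^ card S * laplace_one (touchard (?n - card S) * ?R)) =
          (\<Sum>s\<le>?n. real (?n choose s) * ((-1) ^ s * laplace_one (touchard (?n - s) * ?R)))"
        using sum_Pow_card[of "X \<inter> W" "\<lambda>s. (-1) ^ s * laplace_one (touchard (?n - s) * ?R)"]
          psubset.hyps by simp
      also have "\<dots> = laplace_one ((\<Sum>s\<le>?n. smult (real (?n choose s) * (-1) ^ s) (touchard (?n - s))) * ?R)"
        by (simp add: sum_distrib_right laplace_one_sum laplace_one_smult mult.assoc)
      also have "\<dots> = laplace_one (touchard ?n * ?R - pderiv (touchard ?n) * ?R)"
        by (simp only: touchard_binomial_transform left_diff_distrib)
      also have "\<dots> = laplace_one (touchard ?n * ?R) - laplace_one (pderiv (touchard ?n) * ?R)"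
        using laplace_one_add[of "touchard ?n * ?R - pderiv (touchard ?n) * ?R" "pderiv (touchard ?n) * ?R"]
        by simp
      finally show "(\<Sum>S\<in>?J X. (-1) ^ card S * ?a (W - S)) = - laplace_one (pderiv (touchard ?n) * ?R)"
        by simp
    qed
    \<comment> \<open>The contributions of the parts add up to the product rule.\<close>
    also have "\<dots> = - laplace_one (pderiv (?F W))"
      by (simp add: pderiv_prod laplace_one_sum sum_negf mult.commute)
    also have "\<dots> = coeff (?F W) 0 - laplace_one (?F W)"
      by (simp add: laplace_one_pderiv)
    \<comment> \<open>Some part meets \<open>W\<close>, and its factor has no constant term.\<close>
    also have "coeff (?F W) 0 = 0"
    proof -
      obtain X where "X \<in> P" "X \<inter> W \<noteq> {}" using False psubset.prems by blast
      then have "(\<Prod>X\<in>P. coeff (touchard (card (X \<inter> W))) 0) = 0"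
        using P(1) psubset.hyps by (intro prod_zero) (auto simp: coeff_touchard_0)
      then show ?thesis by (simp add: poly_0_coeff_0[symmetric] poly_prod)
    qed
    finally show ?thesis by simp
  qed
qed

section \<open>Coefficient bounds for power series\<close>

unbundle fps_syntax

text \<open>Coefficientwise majorisation; it forces the coefficients of \<open>g\<close> to be
  nonnegative.\<close>

definition fps_dominated :: "real fps \<Rightarrow> real fps \<Rightarrow> bool" where
  "fps_dominated f g \<longleftrightarrow> (\<forall>k. \<bar>f $ k\<bar> \<le> g $ k)"

lemma fps_dominatedD: "fps_dominated f g \<Longrightarrow> \<bar>f $ k\<bar> \<le> g $ k"
  by (simp add: fps_dominated_def)

lemma fps_dominated_one: "fps_dominated 1 1"
  by (simp add: fps_dominated_def)

lemma fps_dominated_mult: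
  assumes "fps_dominated f F" "fps_dominated g G"
  shows "fps_dominated (f * g) (F * G)"
  unfolding fps_dominated_def
proof
  fix k
  have "\<bar>(f * g) $ k\<bar> \<le> (\<Sum>i=0..k. \<bar>f $ i\<bar> * \<bar>g $ (k - i)\<bar>)"
    unfolding fps_mult_nth by (rule order.trans[OF sum_abs]) (simp add: abs_mult)
  also have "\<dots> \<le> (F * G) $ k"
    unfolding fps_mult_nth using assms unfolding fps_dominated_def
    by (intro sum_mono mult_mono) (auto intro: order.trans[OF abs_ge_zero])
  finally show "\<bar>(f * g) $ k\<bar> \<le> (F * G) $ k" .
qed

lemma fps_dominated_power:
  "fps_dominated f F \<Longrightarrow> fps_dominated (f ^ n) (F ^ n)"
  by (induction n) (auto simp: fps_dominated_one fps_dominated_mult)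

lemma fps_dominated_prod:
  "(\<And>i. i \<in> I \<Longrightarrow> fps_dominated (f i) (F i)) \<Longrightarrow> fps_dominated (\<Prod>i\<in>I. f i) (\<Prod>i\<in>I. F i)"
  by (induction I rule: infinite_finite_induct) (auto simp: fps_dominated_one fps_dominated_mult)

section \<open>Reversed Touchard polynomials and their exponential majorants\<close>

definition reversed_touchard :: "nat \<Rightarrow> real fps" where
  "reversed_touchard j = fps_of_poly (reflect_poly (touchard j))"

lemma reversed_touchard_nth:
  "reversed_touchard j $ k = (if k \<le> j then coeff (touchard j) (j - k) else 0)"
  by (simp add: reversed_touchard_def coeff_reflect_poly)

lemma reversed_touchard_nth_0 [simp]: "reversed_touchard j $ 0 = 1"
  by (simp add: reversed_touchard_nth)

text \<open>The recursion of \<open>touchard\<close> read from the top degree down; the derivative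
  supplies the factor \<open>j - k\<close>. The difference is taken in the reals, and for
  \<open>k > j\<close> the coefficient beside it is zero.\<close>

lemma reversed_touchard_Suc_nth_Suc:
  "reversed_touchard (Suc j) $ Suc k =
     reversed_touchard j $ Suc k - (real j - real k) * reversed_touchard j $ k"
proof -
  consider "Suc k \<le> j" | "k = j" | "k > j" by linarith
  then show ?thesis
  proof cases
    case 1
    then have "j - k = Suc (j - Suc k)" by simp
    then show ?thesis using 1 by (simp add: reversed_touchard_nth coeff_pderiv of_nat_diff)
  qed (auto simp: reversed_touchard_nth)
qed

lemma reversed_touchard_nth_ge:
  "k \<ge> j \<Longrightarrow> k > 0 \<Longrightarrow> reversed_touchard j $ k = 0"
  by (cases "k = j") (auto simp: reversed_touchard_nth coeff_touchard_0)

text \<open>Up to sign this is the Stirling number S(j, j-1), the number of pairs.\<close>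

lemma reversed_touchard_nth_1: "reversed_touchard j $ 1 = coef_A j"
proof (induction j)
  case (Suc j)
  then show ?case
    using reversed_touchard_Suc_nth_Suc[of j 0] by (simp add: coef_A_def field_simps)
qed (simp add: coef_A_def reversed_touchard_nth)

text \<open>This is the Stirling number S(j, j-2) in closed form.\<close>

lemma reversed_touchard_nth_2: "reversed_touchard j $ 2 = coef_B j"
proof (induction j)
  case (Suc j)
  have "reversed_touchard (Suc j) $ 2 = coef_B j - (real j - 1) * coef_A j"
    using reversed_touchard_Suc_nth_Suc[of j 1] reversed_touchard_nth_1[of j] Suc
    by (simp add: numeral_2_eq_2)
  also have "\<dots> = coef_B (Suc j)"
    by (simp add: coef_A_def coef_B_def field_simps)
  finally show ?case .
qed (simp add: coef_B_def reversed_touchard_nth)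

lemma power_add_ge_two_terms:
  fixes x y :: real
  assumes "x \<ge> 0" "y \<ge> 0"
  shows "x ^ Suc k + real (Suc k) * y * x ^ k \<le> (x + y) ^ Suc k"
proof (induction k)
  case (Suc k)
  have "x ^ Suc (Suc k) + real (Suc (Suc k)) * y * x ^ Suc k \<le> 
      (x + y) * (x ^ Suc k + real (Suc k) * y * x ^ k)"
    using assms by (simp add: algebra_simps)
  also have "\<dots> \<le> (x + y) * (x + y) ^ Suc k"
    using assms by (intro mult_left_mono Suc) auto
  finally show ?case by simp
qed simp

text \<open>Induction along \<open>- coef_A (Suc j) = - coef_A j + j\<close>: the recursion adds at
  most \<open>j\<close> times the previous coefficient, which the first two binomial terms of
  \<open>(x + j) ^ Suc i\<close> absorb.\<close>

lemma reversed_touchard_dominated: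
  "fps_dominated (reversed_touchard j) (fps_exp (- coef_A j))"
  unfolding fps_dominated_def
proof (rule allI, induction j)
  case 0
  then show ?case by (simp add: reversed_touchard_nth coef_A_def)
next
  case (Suc j)
  show ?case
  proof (cases k)
    case 0
    then show ?thesis by simp
  next
    case k: (Suc i)
    define x where "x = - coef_A j"
    have x: "x \<ge> 0" by (cases j) (auto simp: x_def coef_A_def)
    have x': "- coef_A (Suc j) = x + real j" by (simp add: x_def coef_A_def field_simps)
    \<comment> \<open>The estimate \<open>\<bar>real j - real i\<bar> \<le> real j\<close> may fail
      for \<open>i > j\<close>, but the coefficient vanishes there.\<close>
    have "\<bar>(real j - real i) * reversed_touchard j $ i\<bar> \<le> real j * (x ^ i / fact i)"
    proof (cases "i \<le> j")
      case True
      then have "\<bar>real j - real i\<bar> \<le> real j" by simp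
      then show ?thesis unfolding abs_mult using Suc.IH[of i] x
        by (intro mult_mono) (auto simp: x_def fps_exp_nth)
    next
      case False
      then show ?thesis using x by (simp add: reversed_touchard_nth)
    qed
    then have "\<bar>reversed_touchard (Suc j) $ k\<bar> \<le> x ^ Suc i / fact (Suc i) + real j * (x ^ i / fact i)"
      unfolding k reversed_touchard_Suc_nth_Suc using Suc.IH[of "Suc i"]
      unfolding fps_exp_nth x_def of_nat_fact by linarith
    also have "real j * (x ^ i / fact i) = real (Suc i) * real j * x ^ i / fact (Suc i)"
      by (simp add: fact_Suc del: of_nat_Suc)
    also have "x ^ Suc i / fact (Suc i) + real (Suc i) * real j * x ^ i / fact (Suc i) =
        (x ^ Suc i + real (Suc i) * real j * x ^ i) / fact (Suc i)"
      by (rule add_divide_distrib[symmetric])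
    also have "\<dots> \<le> (x + real j) ^ Suc i / fact (Suc i)"
      using x by (intro divide_right_mono power_add_ge_two_terms) auto
    finally show ?thesis unfolding k x' fps_exp_nth of_nat_fact .
  qed
qed

lemma fps_exp_sum: "fps_exp (\<Sum>i\<in>I. c i) = (\<Prod>i\<in>I. fps_exp (c i :: 'a :: field_char_0))"
  by (induction I rule: infinite_finite_induct) (auto simp: fps_exp_add_mult)

text \<open>Without linear terms no cross product reaches degree 2, so the quadratic coefficients
  simply add.\<close>

lemma prod_unit_quadratic_nth:
  fixes f :: "'i \<Rightarrow> real fps"
  assumes "\<And>i. i \<in> I \<Longrightarrow> f i $ 0 = 1" "\<And>i. i \<in> I \<Longrightarrow> f i $ 1 = 0"
  shows "(\<Prod>i\<in>I. f i) $ 0 = 1 \<and> (\<Prod>i\<in>I. f i) $ 1 = 0 \<and> (\<Prod>i\<in>I. f i) $ 2 = (\<Sum>i\<in>I. f i $ 2)"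
  using assms
proof -
  have mult2: "(g * h) $ 2 = g $ 0 * h $ 2 + g $ 1 * h $ 1 + g $ 2 * h $ 0" for g h :: "real fps"
    by (simp add: fps_mult_nth numeral_2_eq_2)
  show ?thesis
    using assms
    by (induction I rule: infinite_finite_induct) (simp_all add: mult2 fps_mult_nth_1)
qed

text \<open>The series exp (\<beta> y) - 1 - \<beta> y.\<close>

definition tail_exp :: "real \<Rightarrow> real fps" where
  "tail_exp \<beta> = Abs_fps (\<lambda>k. if k \<le> 1 then 0 else \<beta> ^ k / fact k)"

lemma tail_exp_power_nth_eq_0: "n < 2 * t \<Longrightarrow> tail_exp \<beta> ^ t $ n = 0"
proof (induction t arbitrary: n)
  case (Suc t)
  have "tail_exp \<beta> $ i * tail_exp \<beta> ^ t $ (n - i) = 0" if "i \<le> n" for i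
    using Suc that by (cases "i \<le> 1") (auto simp: tail_exp_def)
  then show ?case unfolding power_Suc fps_mult_nth by (intro sum.neutral) simp
qed simp

lemma tail_exp_power_dominated:
  assumes "\<beta> \<ge> 0"
  shows "fps_dominated (tail_exp \<beta> ^ t) (fps_exp (real t * \<beta>))"
proof -
  have "fps_dominated (tail_exp \<beta>) (fps_exp \<beta>)"
    using assms by (simp add: fps_dominated_def tail_exp_def fps_exp_nth)
  then show ?thesis using fps_dominated_power[of _ "fps_exp \<beta>" t] by (simp add: fps_exp_power_mult)
qed

text \<open>Bounds the \<open>i\<close>-th coefficient of \<open>\<Sum>t. (tail_exp \<beta>)^t / t!\<close>.\<close>

definition tail_majorant :: "real \<Rightarrow> nat \<Rightarrow> real" where
  "tail_majorant \<beta> i = (\<Sum>t\<le>i. (real t * \<beta>) ^ i / (fact i * fact t))"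

lemma tail_majorant_nonneg: "\<beta> \<ge> 0 \<Longrightarrow> tail_majorant \<beta> i \<ge> 0"
  by (auto simp: tail_majorant_def intro!: sum_nonneg)

text \<open>Summing over \<open>i\<close> first gives exp (t \<beta> M) / t!, and then summing over
  \<open>t\<close> gives exp (exp (\<beta> M)), a bound for all partial sums.\<close>

lemma summable_tail_majorant:
  assumes "\<beta> \<ge> 0" "M \<ge> 0"
  shows "summable (\<lambda>i. tail_majorant \<beta> i * M ^ i)"
proof (rule summableI_nonneg_bounded)
  fix n
  have ex: "(\<Sum>i<n. x ^ i / fact i) \<le> exp x" if "x \<ge> 0" for x :: real
    using that sum_le_suminf[OF summable_exp_generic[of x], of "{..<n}"]
    by (auto simp: exp_def divide_inverse mult.commute)
  have "(\<Sum>i<n. tail_majorant \<beta> i * M ^ i) =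
      (\<Sum>i<n. \<Sum>t\<le>i. (real t * \<beta> * M) ^ i / (fact i * fact t))"
    by (simp add: tail_majorant_def sum_distrib_right power_mult_distrib)
  also have "\<dots> \<le> (\<Sum>i<n. \<Sum>t<n. (real t * \<beta> * M) ^ i / (fact i * fact t))"
    using assms by (intro sum_mono sum_mono2) auto
  also have "\<dots> = (\<Sum>t<n. (\<Sum>i<n. (real t * \<beta> * M) ^ i / fact i) / fact t)"
    by (subst sum.swap) (simp add: sum_divide_distrib)
  also have "\<dots> \<le> (\<Sum>t<n. exp (real t * \<beta> * M) / fact t)"
    using assms by (intro sum_mono divide_right_mono ex) auto
  also have "\<dots> = (\<Sum>t<n. exp (\<beta> * M) ^ t / fact t)"
    by (simp add: exp_of_nat_mult mult.assoc)
  also have "\<dots> \<le> exp (exp (\<beta> * M))"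
    by (intro ex) auto
  finally show "(\<Sum>i<n. tail_majorant \<beta> i * M ^ i) \<le> exp (exp (\<beta> * M))" .
qed (use assms in \<open>simp add: tail_majorant_nonneg\<close>)

text \<open>Since \<open>tail_exp \<beta> ^ t\<close> starts in degree \<open>2 * t\<close>, only powers with \<open>t \<le> i / 2\<close>, hence \<open>t \<le> i - 2\<close>,
  contribute.\<close>

lemma one_plus_tail_exp_power_nth_le:
  assumes "\<beta> \<ge> 0" "R \<le> N" "N > 0" "i \<ge> 3"
  shows "(1 + tail_exp \<beta>) ^ R $ i \<le> real N ^ (i - 2) * tail_majorant \<beta> i"
proof -
  have nn: "tail_exp \<beta> ^ t $ i \<ge> 0" for t
  proof -
    have "fps_dominated (tail_exp \<beta>) (tail_exp \<beta>)" using assms by (simp add: fps_dominated_def tail_exp_def)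
    from fps_dominatedD[OF fps_dominated_power[OF this, of t], of i] show ?thesis by linarith
  qed
  have up: "tail_exp \<beta> ^ t $ i \<le> (real t * \<beta>) ^ i / fact i" for t
    using fps_dominatedD[OF tail_exp_power_dominated[OF assms(1), of t], of i] by (simp add: fps_exp_nth)
  have "(1 + tail_exp \<beta>) ^ R $ i = (\<Sum>t\<le>R. real (R choose t) * tail_exp \<beta> ^ t $ i)"
  proof -
    have "(tail_exp \<beta> + 1) ^ R = (\<Sum>t\<le>R. fps_const (real (R choose t)) * tail_exp \<beta> ^ t)"
      by (simp add: binomial_ring fps_of_nat)
    then show ?thesis by (simp add: add.commute fps_sum_nth)
  qed
  \<comment> \<open>The range is enlarged to cover both cases \<open>R < i\<close> and
    \<open>R \<ge> i\<close>; all terms with \<open>t > i\<close> then vanish.\<close>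
  also have "\<dots> \<le> (\<Sum>t\<le>max R i. real (R choose t) * tail_exp \<beta> ^ t $ i)"
    using nn by (intro sum_mono2) auto
  also have "\<dots> = (\<Sum>t\<le>i. real (R choose t) * tail_exp \<beta> ^ t $ i)"
    by (intro sum.mono_neutral_right) (auto simp: tail_exp_power_nth_eq_0)
  also have "\<dots> \<le> (\<Sum>t\<le>i. real N ^ (i - 2) * ((real t * \<beta>) ^ i / (fact i * fact t)))"
  proof (rule sum_mono)
    fix t assume "t \<in> {..i}"
    show "real (R choose t) * tail_exp \<beta> ^ t $ i \<le> real N ^ (i - 2) * ((real t * \<beta>) ^ i / (fact i * fact t))"
    proof (cases "i < 2 * t")
      case True
      then show ?thesis using assms by (simp add: tail_exp_power_nth_eq_0)
    next
      case False
      have "real (R choose t) * fact t \<le> real R ^ t"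
        using binomial_fact_pow[of R t] by (metis of_nat_fact of_nat_le_iff of_nat_mult of_nat_power)
      also have "\<dots> \<le> real N ^ t"
        using assms by (intro power_mono) auto
      also have "\<dots> \<le> real N ^ (i - 2)"
        using assms False by (intro power_increasing) auto
      finally have "real (R choose t) \<le> real N ^ (i - 2) / fact t" by (simp add: field_simps)
      then have "real (R choose t) * tail_exp \<beta> ^ t $ i \<le> real N ^ (i - 2) / fact t * ((real t * \<beta>) ^ i / fact i)"
        using nn[of t] up[of t] by (intro mult_mono) auto
      then show ?thesis by (simp add: field_simps)
    qed
  qed
  finally show ?thesis by (simp add: tail_majorant_def sum_distrib_left)
qed

section \<open>Weighted coefficient sums\<close>

text \<open>For \<open>k \<le> N\<close> this is the product of 1 / (1 - i/N) over
  \<open>i < k\<close>.\<close>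

definition falling_ratio :: "nat \<Rightarrow> nat \<Rightarrow> real" where
  "falling_ratio N k = real N ^ k * fact (N - k) / fact N"

text \<open>One induction proves all bounds, since each order of accuracy feeds the next. Passing
  from \<open>k\<close> to \<open>Suc k\<close> multiplies by \<rho> = N / (N - k), and
  \<open>N \<le> M * (N - k)\<close> says that \<rho> is at most \<open>M\<close>.\<close>

lemma falling_ratio_bounds:
  assumes "N > 0" "k \<le> N" "N \<le> M * (N - k)"
  shows "1 \<le> falling_ratio N k \<and> falling_ratio N k \<le> real M ^ k
    \<and> falling_ratio N k - 1 \<le> real M ^ k * real k ^ 2 / real N
    \<and> 0 \<le> falling_ratio N k - 1 - real k * (real k - 1) / (2 * real N)
    \<and> falling_ratio N k - 1 - real k * (real k - 1) / (2 * real N) \<le> real M ^ k * real k ^ 4 / real N ^ 2"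
  using assms(2,3)
proof (induction k)
  case 0
  then show ?case using assms(1) by (simp add: falling_ratio_def)
next
  case (Suc k)
  define n where "n = real N"
  define x where "x = real k"
  define W where "W = falling_ratio N k"
  define \<rho> where "\<rho> = n / (n - x)"
  define P where "P = real M ^ k"
  define e where "e = W - 1 - x * (x - 1) / (2 * n)"
  have xn: "0 \<le> x" "x < n" "n > 0" using Suc.prems by (auto simp: x_def n_def)
  have "M \<ge> 1" using Suc.prems assms(1) by (cases M) auto
  then have M: "real M \<ge> 1" by simp
  have P: "P \<ge> 1" using M unfolding P_def by (rule one_le_power)
  have le: "N \<le> M * (N - k)"
    using Suc.prems(2) by (rule order.trans) (intro mult_le_mono2 diff_le_mono2, simp)
  have IH: "1 \<le> W" "W \<le> P" "W - 1 \<le> P * x ^ 2 / n" "0 \<le> e" "e \<le> P * x ^ 4 / n ^ 2"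
    using Suc.IH[OF _ le] Suc.prems(1) by (auto simp: W_def P_def x_def n_def e_def)
  have \<rho>1: "\<rho> \<ge> 1" using xn by (simp add: \<rho>_def)
  have "real N \<le> real (M * (N - k))" using le by (simp only: of_nat_le_iff)
  then have \<rho>M: "\<rho> \<le> real M"
    using xn Suc.prems(1) by (simp add: \<rho>_def divide_le_eq n_def x_def of_nat_diff)
  \<comment> \<open>Used once, this exact identity gives the recursion for the first-order error;
    used twice, the one for the second-order error.\<close>
  have \<rho>x: "\<rho> - 1 = x / n * \<rho>" using xn by (simp add: \<rho>_def field_simps)
  have W': "falling_ratio N (Suc k) = W * \<rho>"
  proof -
    have "N - k = Suc (N - Suc k)" using Suc.prems(1) by simp
    then have "fact (N - k) = (n - x) * (fact (N - Suc k) :: real)"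
      using Suc.prems(1) by (simp add: n_def x_def of_nat_diff)
    then show ?thesis using xn by (simp add: W_def falling_ratio_def \<rho>_def n_def[symmetric])
  qed
  have s: "real (Suc k) = x + 1" by (simp add: x_def)
  have MP: "real M ^ Suc k = real M * P" by (simp add: P_def)
  have PM: "P \<le> real M * P" using mult_right_mono[OF M, of P] P by simp
  have Wx: "W * \<rho> \<le> P * real M" using IH \<rho>1 \<rho>M P by (intro mult_mono) auto
  have 1: "1 \<le> W * \<rho>" using IH \<rho>1 mult_mono[of 1 W 1 \<rho>] by simp
  have 2: "W * \<rho> - 1 \<le> real M * P * (x + 1) ^ 2 / n"
  proof -
    have "W * \<rho> - 1 = (W - 1) + (W * \<rho>) * (x / n)" using \<rho>x by algebra
    also have "\<dots> \<le> real M * P * x ^ 2 / n + (P * real M) * (x / n)"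
      using xn Wx PM by (intro add_mono mult_right_mono order.trans[OF IH(3)] divide_right_mono) auto
    also have "\<dots> = real M * P * (x ^ 2 + x) / n" using xn by (simp add: field_simps)
    also have "\<dots> \<le> real M * P * (x + 1) ^ 2 / n"
      using xn P by (intro divide_right_mono mult_left_mono) (auto simp: power2_eq_square algebra_simps)
    finally show ?thesis .
  qed
  have e': "W * \<rho> - 1 - (x + 1) * ((x + 1) - 1) / (2 * n) = e + (W - 1) * (x / n) + (W * \<rho>) * (x / n) ^ 2"
  proof -
    have "W * \<rho> = W + W * (x / n) + (W * \<rho>) * (x / n) ^ 2" using \<rho>x by algebra
    moreover have "(x + 1) * ((x + 1) - 1) / (2 * n) = x * (x - 1) / (2 * n) + x / n"
      using xn by (simp add: field_simps)
    moreover have "(W - 1) * (x / n) = W * (x / n) - x / n" using xn by (simp add: field_simps)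
    ultimately show ?thesis unfolding e_def by linarith
  qed
  have 3: "0 \<le> e + (W - 1) * (x / n) + (W * \<rho>) * (x / n) ^ 2"
    using IH xn \<rho>1 by (intro add_nonneg_nonneg mult_nonneg_nonneg) auto
  have 4: "e + (W - 1) * (x / n) + (W * \<rho>) * (x / n) ^ 2 \<le> real M * P * (x + 1) ^ 4 / n ^ 2"
  proof -
    have "e + (W - 1) * (x / n) + (W * \<rho>) * (x / n) ^ 2 \<le>
        real M * P * x ^ 4 / n ^ 2 + (real M * P * x ^ 2 / n) * (x / n) + (P * real M) * (x / n) ^ 2"
      using xn Wx PM 
      by (intro add_mono mult_right_mono order.trans[OF IH(3)] order.trans[OF IH(5)] divide_right_mono) auto
    also have "\<dots> = real M * P * (x ^ 4 + x ^ 3 + x ^ 2) / n ^ 2"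
      using xn by (simp add: field_simps power2_eq_square power3_eq_cube)
    also have "\<dots> \<le> real M * P * (x + 1) ^ 4 / n ^ 2"
    proof (intro divide_right_mono mult_left_mono)
      have "(x + 1) ^ 4 = x ^ 4 + x ^ 3 + x ^ 2 + (3 * x ^ 3 + 5 * x ^ 2 + 4 * x + 1)"
        by (simp add: power4_eq_xxxx power2_eq_square power3_eq_cube algebra_simps)
      also have "\<dots> \<ge> x ^ 4 + x ^ 3 + x ^ 2" using xn by simp
      finally show "x ^ 4 + x ^ 3 + x ^ 2 \<le> (x + 1) ^ 4" .
    qed (use P in auto)
    finally show ?thesis .
  qed
  show ?case
    unfolding W' MP s n_def[symmetric] e' using 1 2 3 4 Wx by (simp add: mult.commute)
qed

text \<open>The cutoff only removes terms whose coefficient vanishes anyway (\<open>reversed_touchard_prod_nth_eq_0\<close>);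
  it gives the weights a bound \<open>M ^ k\<close> that is uniform in \<open>N\<close>.\<close>

definition weight :: "nat \<Rightarrow> nat \<Rightarrow> nat \<Rightarrow> real" where
  "weight M N k = (if k \<le> N \<and> N \<le> M * (N - k) then falling_ratio N k else 0)"

lemma power2_le_4_power: "real k ^ 2 \<le> 4 ^ k" and power4_le_16_power: "real k ^ 4 \<le> 16 ^ k"
proof -
  have "real k \<le> 2 ^ k" using of_nat_less_two_power[of k, where 'a = real] by simp
  then have "real k ^ 2 \<le> (2 ^ k) ^ 2" "real k ^ 4 \<le> (2 ^ k) ^ 4" by (intro power_mono; simp)+
  moreover have "((2 :: real) ^ k) ^ 2 = 4 ^ k" "((2 :: real) ^ k) ^ 4 = 16 ^ k"
    by (simp_all add: power_mult[symmetric] mult.commute[of k] power_mult)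
  ultimately show "real k ^ 2 \<le> 4 ^ k" "real k ^ 4 \<le> 16 ^ k" by simp_all
qed

text \<open>Where the cutoff acts, \<open>N\<close> is below \<open>2 * k\<close>, so powers of
  \<open>N\<close> are bounded by exponentials in \<open>k\<close> and replacing the weight by zero
  fits into the error terms.\<close>

lemma weight_outside:
  fixes M N k :: nat
  assumes "M \<ge> 2" "\<not> (k \<le> N \<and> N \<le> M * (N - k))"
  shows "N < 2 * k"
proof (cases "k \<le> N")
  case True
  have "2 * (N - k) \<le> M * (N - k)" using assms(1) by simp
  also have "\<dots> < N" using assms(2) True by simp
  finally show ?thesis using True by simp
qed simp

lemma weight_abs_le:
  assumes "N > 0"
  shows "\<bar>weight M N k\<bar> \<le> real M ^ k"
  using falling_ratio_bounds[OF assms, of k M] by (auto simp: weight_def)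

lemma weight_minus_one_abs_le:
  assumes "M \<ge> 2" "N > 0"
  shows "\<bar>weight M N k - 1\<bar> \<le> 2 * (4 * real M) ^ k / real N"
proof (cases "k \<le> N \<and> N \<le> M * (N - k)")
  case True
  then have "0 \<le> weight M N k - 1" "weight M N k - 1 \<le> real M ^ k * real k ^ 2 / real N"
    using falling_ratio_bounds[OF assms(2), of k M] by (auto simp: weight_def)
  moreover have "real M ^ k * real k ^ 2 / real N \<le> real M ^ k * 4 ^ k / real N"
    by (intro divide_right_mono mult_left_mono power2_le_4_power) auto
  moreover have "real M ^ k * 4 ^ k / real N \<le> 2 * (4 * real M) ^ k / real N"
    by (intro divide_right_mono) (auto simp: power_mult_distrib)
  ultimately show ?thesis by simp
next
  case False
  have k: "N < 2 * k" using weight_outside[OF assms(1) False] .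
  have "1 \<le> real M ^ k" using assms by (intro one_le_power) simp
  moreover have "real k \<le> 4 ^ k"
    using power2_le_4_power[of k] k self_le_power[of "real k" 2] by simp
  ultimately have "1 * real k \<le> real M ^ k * 4 ^ k" by (intro mult_mono) auto
  then have "real N \<le> 2 * (4 * real M) ^ k" using k by (simp add: power_mult_distrib mult.commute)
  then show ?thesis unfolding weight_def if_not_P[OF False] using assms by (simp add: le_divide_eq)
qed

lemma weight_expansion_abs_le:
  assumes "M \<ge> 2" "N > 0"
  shows "\<bar>weight M N k - 1 - real k * (real k - 1) / (2 * real N)\<bar> \<le> 8 * (16 * real M) ^ k / real N ^ 2"
proof (cases "k \<le> N \<and> N \<le> M * (N - k)")
  case True
  then have "0 \<le> weight M N k - 1 - real k * (real k - 1) / (2 * real N)"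
    "weight M N k - 1 - real k * (real k - 1) / (2 * real N) \<le> real M ^ k * real k ^ 4 / real N ^ 2"
    using falling_ratio_bounds[OF assms(2), of k M] by (auto simp: weight_def)
  moreover have "real M ^ k * real k ^ 4 / real N ^ 2 \<le> real M ^ k * 16 ^ k / real N ^ 2"
    by (intro divide_right_mono mult_left_mono power4_le_16_power) auto
  moreover have "real M ^ k * 16 ^ k / real N ^ 2 \<le> 8 * (16 * real M) ^ k / real N ^ 2"
    by (intro divide_right_mono) (auto simp: power_mult_distrib)
  ultimately show ?thesis by simp
next
  case False
  \<comment> \<open>The weight is zero here, so the left-hand side is 1 + x (x - 1) / (2 n). After
    multiplication by \<open>n^2\<close>, the inequality \<open>n < 2 * x\<close> bounds it by
    \<open>8 * x^4\<close>.\<close>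
  define x n where "x = real k" and "n = real N"
  have "N < 2 * k" using weight_outside[OF assms(1) False] .
  then have x: "n < 2 * x" "n > 0" "1 \<le> x" using assms by (auto simp: x_def n_def)
  have "n ^ 2 \<le> (2 * x) ^ 2" using x by (intro power_mono) auto
  then have "n ^ 2 \<le> 4 * x ^ 2" by simp
  moreover have "n * (x * (x - 1)) \<le> (2 * x) * (x * x)"
    using x by (intro mult_mono) auto
  then have "n * (x * (x - 1)) \<le> 2 * x ^ 3" by (simp add: power3_eq_cube)
  moreover have "x ^ 4 \<ge> 0" by simp
  moreover have "x ^ 2 \<le> x ^ 4" "x ^ 3 \<le> x ^ 4" using x by (auto intro: power_increasing)
  ultimately have "n ^ 2 + n * (x * (x - 1)) / 2 \<le> 8 * x ^ 4"
    by linarith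
  also have "\<dots> \<le> 8 * (1 * 16 ^ k)" unfolding x_def using power4_le_16_power[of k] by simp
  also have "\<dots> \<le> 8 * (real M ^ k * 16 ^ k)"
    using assms by (intro mult_left_mono mult_right_mono one_le_power) auto
  finally have "n ^ 2 + n * (x * (x - 1)) / 2 \<le> 8 * (16 * real M) ^ k"
    by (simp add: power_mult_distrib mult.commute)
  then have "(n ^ 2 + n * (x * (x - 1)) / 2) / n ^ 2 \<le> 8 * (16 * real M) ^ k / n ^ 2"
    by (rule divide_right_mono) simp
  also have "(n ^ 2 + n * (x * (x - 1)) / 2) / n ^ 2 = 1 + x * (x - 1) / (2 * n)"
    using x by (simp add: add_divide_distrib power2_eq_square)
  finally have "1 + x * (x - 1) / (2 * n) \<le> 8 * (16 * real M) ^ k / n ^ 2" .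
  moreover have "x * (x - 1) / (2 * n) \<ge> 0" using x by simp
  ultimately have "\<bar>0 - 1 - x * (x - 1) / (2 * n)\<bar> \<le> 8 * (16 * real M) ^ k / n ^ 2" by linarith
  then show ?thesis unfolding weight_def if_not_P[OF False] x_def n_def .
qed

text \<open>The coefficients of y^2 exp (a y).\<close>

definition shifted_exp_term :: "real \<Rightarrow> nat \<Rightarrow> real" where
  "shifted_exp_term a k = (if k < 2 then 0 else a ^ (k - 2) / fact (k - 2))"

lemma exp_term_sums: "(\<lambda>k. a ^ k / fact k) sums exp (a :: real)"
  using exp_converges[of a] by (simp add: divide_inverse mult.commute)

lemma shifted_exp_term_sums: "shifted_exp_term a sums exp a"
proof -
  have "(\<lambda>k. shifted_exp_term a (k + 2)) sums exp a"
    using exp_term_sums[of a] by (simp add: shifted_exp_term_def)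
  then show ?thesis using sums_iff_shift[of "shifted_exp_term a" 2 "exp a"]
    by (simp add: shifted_exp_term_def numeral_2_eq_2)
qed

text \<open>Half of y^2 times the second derivative of exp (a y), coefficientwise. This turns the
  first-order correction of the weights into the term \<open>\<mu>1^2 / 2\<close>.\<close>

lemma exp_term_second_factorial_moment:
  "real k * (real k - 1) / 2 * (a ^ k / fact k) = a ^ 2 / 2 * shifted_exp_term a k"
proof (cases "k < 2")
  case True
  then have "k = 0 \<or> k = 1" by auto
  then show ?thesis by (auto simp: shifted_exp_term_def)
next
  case False
  then obtain i where k: "k = Suc (Suc i)" by (metis not_less le_Suc_ex add_2_eq_Suc)
  define p where "p = real k * (real k - 1)"
  have "p = (real i + 2) * (real i + 1)" by (simp add: p_def k algebra_simps)
  then have "p > 0" by simp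
  moreover have "fact k = p * fact i" "a ^ k = a ^ 2 * a ^ i"
    by (simp_all add: p_def k power2_eq_square algebra_simps)
  moreover have "shifted_exp_term a k = a ^ i / fact i" by (simp add: k shifted_exp_term_def)
  ultimately show ?thesis unfolding p_def[symmetric] by simp
qed

lemma shifted_exp_term_abs_le:
  "\<bar>a\<bar> \<le> K \<Longrightarrow> \<bar>shifted_exp_term a k\<bar> \<le> shifted_exp_term K k"
  by (auto simp: shifted_exp_term_def abs_mult power_abs intro!: divide_right_mono power_mono)

lemma summable_scaled_shifted_exp_term:
  "summable (\<lambda>k. c ^ k * shifted_exp_term K k)"
proof -
  have "(\<lambda>k. c ^ k * shifted_exp_term K k) = (\<lambda>k. c ^ 2 * shifted_exp_term (c * K) k)"
  proof
    fix k
    show "c ^ k * shifted_exp_term K k = c ^ 2 * shifted_exp_term (c * K) k"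
    proof (cases "k < 2")
      case False
      then have "c ^ k = c ^ 2 * c ^ (k - 2)" by (metis le_add_diff_inverse not_less power_add)
      then show ?thesis using False by (simp add: shifted_exp_term_def power_mult_distrib)
    qed (simp add: shifted_exp_term_def)
  qed
  then show ?thesis using shifted_exp_term_sums[of "c * K"] by (simp add: sums_iff)
qed

text \<open>The coefficients of exp (K y) times the series with coefficients
  \<open>h\<close>.\<close>

definition exp_convolution :: "(nat \<Rightarrow> real) \<Rightarrow> real \<Rightarrow> nat \<Rightarrow> real" where
  "exp_convolution h K k = (\<Sum>i\<le>k. h i * (K ^ (k - i) / fact (k - i)))"

lemma summable_exp_convolution:
  assumes "\<And>i. h i \<ge> 0" "K \<ge> 0" "M \<ge> 0" "summable (\<lambda>i. h i * M ^ i)"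
  shows "summable (\<lambda>k. exp_convolution h K k * M ^ k)"
proof -
  have "summable (\<lambda>k. \<Sum>i\<le>k. (h i * M ^ i) * ((K * M) ^ (k - i) / fact (k - i)))"
  proof (rule summable_Cauchy_product)
    show "summable (\<lambda>k. norm (h k * M ^ k))"
      using assms by (simp add: abs_mult)
    show "summable (\<lambda>k. norm ((K * M) ^ k / fact k))"
      using exp_term_sums[of "K * M"] assms by (simp add: sums_iff abs_mult)
  qed
  moreover have "(\<Sum>i\<le>k. (h i * M ^ i) * ((K * M) ^ (k - i) / fact (k - i))) = exp_convolution h K k * M ^ k" for k
    unfolding exp_convolution_def sum_distrib_right
  proof (rule sum.cong[OF refl])
    fix i assume "i \<in> {..k}"
    then have "M ^ k = M ^ i * M ^ (k - i)" by (simp flip: power_add)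
    then show "(h i * M ^ i) * ((K * M) ^ (k - i) / fact (k - i)) = h i * (K ^ (k - i) / fact (k - i)) * M ^ k"
      by (simp add: power_mult_distrib)
  qed
  ultimately show ?thesis by simp
qed

text \<open>Degrees 0 and 2 of \<open>\<gamma>\<close> produce the two subtracted terms, degree 1 is
  absent, and the rest is majorised termwise.\<close>

lemma exp_convolution_expand:
  assumes "\<gamma> 0 = 1" "\<gamma> 1 = 0" "\<And>i. i \<ge> 3 \<Longrightarrow> \<bar>\<gamma> i\<bar> \<le> c * h i" "\<And>i. h i \<ge> 0" "c \<ge> 0" "\<bar>a\<bar> \<le> K"
  shows "\<bar>exp_convolution \<gamma> a k - a ^ k / fact k - \<gamma> 2 * shifted_exp_term a k\<bar> \<le> c * exp_convolution h K k"
proof -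
  let ?t = "\<lambda>i. a ^ (k - i) / fact (k - i)"
  have K: "K \<ge> 0" using assms(6) by linarith
  define \<delta> where "\<delta> i = (if i \<ge> 3 then \<gamma> i else 0)" for i :: nat
  have "\<gamma> i * ?t i = (if i = 0 then ?t 0 else 0) + (if i = 2 then \<gamma> 2 * ?t 2 else 0) + \<delta> i * ?t i" for i
  proof -
    consider "i = 0" | "i = 1" | "i = 2" | "i \<ge> 3" by linarith
    then show ?thesis by cases (use assms in \<open>auto simp: \<delta>_def\<close>)
  qed
  then have "exp_convolution \<gamma> a k =
      (\<Sum>i\<le>k. (if i = 0 then ?t 0 else 0) + (if i = 2 then \<gamma> 2 * ?t 2 else 0) + \<delta> i * ?t i)"
    unfolding exp_convolution_def by (intro sum.cong) auto
  also have "\<dots> = a ^ k / fact k + \<gamma> 2 * shifted_exp_term a k + (\<Sum>i\<le>k. \<delta> i * ?t i)"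
    by (simp add: sum.distrib shifted_exp_term_def not_less)
  finally have "\<bar>exp_convolution \<gamma> a k - a ^ k / fact k - \<gamma> 2 * shifted_exp_term a k\<bar> = \<bar>\<Sum>i\<le>k. \<delta> i * ?t i\<bar>"
    by simp
  also have "\<dots> \<le> (\<Sum>i\<le>k. \<bar>\<delta> i * ?t i\<bar>)" by (rule sum_abs)
  also have "\<dots> \<le> (\<Sum>i\<le>k. (c * h i) * (K ^ (k - i) / fact (k - i)))"
  proof (rule sum_mono)
    fix i
    have "\<bar>\<delta> i\<bar> \<le> c * h i" using assms(3-5) by (auto simp: \<delta>_def)
    moreover have "\<bar>?t i\<bar> \<le> K ^ (k - i) / fact (k - i)"
      using assms(6) by (auto simp: power_abs intro!: divide_right_mono power_mono)
    ultimately show "\<bar>\<delta> i * ?t i\<bar> \<le> (c * h i) * (K ^ (k - i) / fact (k - i))"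
      unfolding abs_mult using assms(4,5) by (intro mult_mono) auto
  qed
  also have "\<dots> = c * exp_convolution h K k"
    by (simp add: exp_convolution_def sum_distrib_left mult.assoc)
  finally show ?thesis .
qed

text \<open>Three errors with the common factor \<open>1 / N^2\<close> removed: the exponential
  terms times the second-order error of the weights; the quadratic term of \<open>\<gamma>\<close>,
  itself of order \<open>1 / N\<close>, times their first-order error; and the degrees from 3 on
  times the crude bound \<open>M ^ k\<close>.\<close>

definition error_term :: "nat \<Rightarrow> real \<Rightarrow> real \<Rightarrow> (nat \<Rightarrow> real) \<Rightarrow> nat \<Rightarrow> real" where
  "error_term M K L h k =
     8 * ((16 * real M * K) ^ k / fact k) +
     2 * L * ((4 * real M) ^ k * shifted_exp_term K k) +
     exp_convolution h K k * real M ^ k"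

lemma weighted_sum_expansion:
  assumes "M \<ge> 2" "N > 0" and h: "\<And>i. h i \<ge> 0" "summable (\<lambda>i. h i * real M ^ i)"
    and \<gamma>: "\<gamma> 0 = 1" "\<gamma> 1 = 0" "\<gamma> 2 = \<mu> / real N" "\<And>i. i \<ge> 3 \<Longrightarrow> \<bar>\<gamma> i\<bar> \<le> h i / real N ^ 2"
    and a: "\<bar>a\<bar> \<le> K" and \<mu>: "\<bar>\<mu>\<bar> \<le> L"
    and S: "(\<lambda>k. exp_convolution \<gamma> a k * weight M N k) sums S"
  shows "\<bar>S - exp a * (1 + (\<mu> + a ^ 2 / 2) / real N)\<bar> \<le> (\<Sum>k. error_term M K L h k) / real N ^ 2"
proof -
  define n where "n = real N"
  have n: "n > 0" using assms by (simp add: n_def)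
  have K: "K \<ge> 0" and L: "L \<ge> 0" using a \<mu> by linarith+
  define u where "u k = a ^ k / fact k" for k
  define v where "v = shifted_exp_term a"
  define z where "z k = exp_convolution \<gamma> a k - u k - \<mu> / n * v k" for k
  define w where "w = weight M N"
  define d where "d k = exp_convolution \<gamma> a k * w k - (u k + (\<mu> + a ^ 2 / 2) / n * v k)" for k
  have z: "\<bar>z k\<bar> \<le> exp_convolution h K k / n ^ 2" for k
    using exp_convolution_expand[of \<gamma> "1 / n ^ 2" h a K k] \<gamma> h(1) a
    by (simp add: z_def u_def v_def n_def)
  \<comment> \<open>The correction \<open>k (k - 1) / (2 n)\<close> times \<open>u k\<close> equals
    \<open>a^2 / 2 / n * v k\<close>, which is why \<open>d\<close> subtracts the latter along with
    \<open>\<mu> / n * v k\<close>.\<close>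
  have d_eq: "d k = u k * (w k - 1 - real k * (real k - 1) / (2 * n)) + \<mu> / n * v k * (w k - 1) + z k * w k" for k
  proof -
    have "u k * (real k * (real k - 1) / (2 * n)) = a ^ 2 / 2 / n * v k"
      using exp_term_second_factorial_moment[of k a] n by (simp add: u_def v_def field_simps)
    then show ?thesis using n by (simp add: d_def z_def field_simps)
  qed
  have d: "\<bar>d k\<bar> \<le> error_term M K L h k / n ^ 2" for k
  proof -
    have "\<bar>u k\<bar> \<le> K ^ k / fact k"
      using a by (auto simp: u_def power_abs intro!: divide_right_mono power_mono)
    then have "\<bar>u k * (w k - 1 - real k * (real k - 1) / (2 * n))\<bar> \<le> K ^ k / fact k * (8 * (16 * real M) ^ k / n ^ 2)"
      unfolding abs_mult w_def n_def using K weight_expansion_abs_le[OF assms(1,2)] by (intro mult_mono) auto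
    moreover have "\<bar>\<mu> / n * v k * (w k - 1)\<bar> \<le> L / n * shifted_exp_term K k * (2 * (4 * real M) ^ k / n)"
      unfolding abs_mult
    proof (intro mult_mono)
      show "\<bar>\<mu> / n\<bar> \<le> L / n" using \<mu> n by (simp add: abs_divide divide_right_mono)
      show "\<bar>v k\<bar> \<le> shifted_exp_term K k" unfolding v_def by (rule shifted_exp_term_abs_le[OF a])
      show "\<bar>w k - 1\<bar> \<le> 2 * (4 * real M) ^ k / n"
        unfolding w_def n_def by (rule weight_minus_one_abs_le[OF assms(1,2)])
    qed (use L K n in \<open>auto simp: shifted_exp_term_def\<close>)
    moreover have "\<bar>z k * w k\<bar> \<le> exp_convolution h K k / n ^ 2 * real M ^ k"
      unfolding abs_mult using z[of k] weight_abs_le[OF assms(2), of M k]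
      by (intro mult_mono) (auto simp: w_def intro: order.trans[OF abs_ge_zero])
    ultimately have "\<bar>d k\<bar> \<le> K ^ k / fact k * (8 * (16 * real M) ^ k / n ^ 2) +
        L / n * shifted_exp_term K k * (2 * (4 * real M) ^ k / n) + exp_convolution h K k / n ^ 2 * real M ^ k"
      unfolding d_eq by linarith
    also have "\<dots> = error_term M K L h k / n ^ 2"
      using n by (simp add: error_term_def power_mult_distrib add_divide_distrib power2_eq_square mult_ac)
    finally show ?thesis .
  qed
  have sE: "summable (error_term M K L h)"
    unfolding error_term_def
    using exp_term_sums[of "16 * real M * K"] K h
    by (intro summable_add summable_mult summable_scaled_shifted_exp_term summable_exp_convolution)
       (auto simp: sums_iff)
  have sE': "summable (\<lambda>k. error_term M K L h k / n ^ 2)" using sE by (rule summable_divide)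
  have "(\<lambda>k. u k + (\<mu> + a ^ 2 / 2) / n * v k) sums (exp a + (\<mu> + a ^ 2 / 2) / n * exp a)"
    unfolding u_def v_def by (intro sums_add sums_mult exp_term_sums shifted_exp_term_sums)
  from sums_diff[OF S this] have ds: "d sums (S - (exp a + (\<mu> + a ^ 2 / 2) / n * exp a))"
    by (simp add: d_def[abs_def] w_def)
  have "\<bar>\<Sum>k. d k\<bar> \<le> (\<Sum>k. error_term M K L h k / n ^ 2)"
    using norm_suminf_le[OF _ sE', of d] d by simp
  also have "\<dots> = (\<Sum>k. error_term M K L h k) / n ^ 2" by (rule suminf_divide[OF sE])
  finally show ?thesis using sums_unique[OF ds] by (simp add: n_def algebra_simps)
qed

section \<open>The number of acyclic orientations\<close>

text \<open>Parts of size 0 are all empty and cannot be told apart, hence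
  \<open>j \<ge> 1\<close>.\<close>

lemma part_inject: "j \<ge> 1 \<Longrightarrow> part j i = part j' i' \<Longrightarrow> j = j' \<and> i = i'"
proof -
  assume j: "j \<ge> 1" and eq: "part j i = part j' i'"
  have "(j, i, 0) \<in> part j i" using j by (auto simp: Defs.part_def)
  then show ?thesis unfolding eq by (auto simp: Defs.part_def)
qed

lemma parts_eq_image:
  "parts m r = (\<lambda>(j, i). part j i) ` (SIGMA j:{1..m}. {..<r j})"
proof (intro subset_antisym subsetI)
  fix X assume "X \<in> parts m r"
  then obtain j i where "X = part j i" "1 \<le> j" "j \<le> m" "i < r j" by (auto simp: parts_def)
  then show "X \<in> (\<lambda>(j, i). part j i) ` (SIGMA j:{1..m}. {..<r j})"
    by (intro image_eqI[of _ _ "(j, i)"]) auto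
next
  fix X assume "X \<in> (\<lambda>(j, i). part j i) ` (SIGMA j:{1..m}. {..<r j})"
  then obtain j i where "X = part j i" "1 \<le> j" "j \<le> m" "i < r j" by auto
  then show "X \<in> parts m r"
    unfolding parts_def mem_Collect_eq by (intro exI[of _ j] exI[of _ i]) simp
qed

lemma disjoint_parts: "disjoint (parts m r)"
  by (rule disjointI) (auto simp: parts_def Defs.part_def)

lemma card_part: "card (part j i) = j"
proof -
  have "part j i = (\<lambda>k. (j, i, k)) ` {..<j}" by (auto simp: Defs.part_def)
  then show ?thesis by (simp add: card_image inj_on_def)
qed

lemma finite_part: "finite (part j i)"
proof -
  have "part j i = (\<lambda>k. (j, i, k)) ` {..<j}" by (auto simp: Defs.part_def)
  then show ?thesis by simp
qed

lemma num_acyclic_eq_laplace_one: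
  "real (num_acyclic m r) = laplace_one (\<Prod>j = 1..m. touchard j ^ r j)"
proof -
  let ?P = "parts m r"
  have inj: "inj_on (\<lambda>(j, i). part j i) (SIGMA j:{1..m}. {..<r j})"
    by (rule inj_onI) (use part_inject in force)
  have fin: "finite ?P" by (simp add: parts_eq_image)
  have "e \<subseteq> \<Union>?P" if "e \<in> complete_multipartite_edges ?P" for e
    using that unfolding complete_multipartite_edges_def by blast
  then have "induced_edges (complete_multipartite_edges ?P) (\<Union>?P) = complete_multipartite_edges ?P"
    by (auto simp: induced_edges_def)
  moreover have "finite (\<Union>?P)" using fin by (auto simp: parts_def finite_part)
  ultimately have "real (num_acyclic m r) = laplace_one (\<Prod>X\<in>?P. touchard (card (X \<inter> \<Union>?P)))"
    using card_acyclic_orientations_multipartite[OF fin disjoint_parts, of "\<Union>?P"]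
    by (simp add: num_acyclic_def)
  also have "(\<Prod>X\<in>?P. touchard (card (X \<inter> \<Union>?P))) = (\<Prod>X\<in>?P. touchard (card X))"
    by (intro prod.cong refl arg_cong[where f = touchard] arg_cong[where f = card]) auto
  also have "\<dots> = (\<Prod>(j, i)\<in>(SIGMA j:{1..m}. {..<r j}). touchard j)"
    unfolding parts_eq_image
    by (subst prod.reindex[OF inj]) (simp add: card_part case_prod_beta)
  also have "\<dots> = (\<Prod>j = 1..m. touchard j ^ r j)"
    by (subst prod.Sigma[symmetric]) auto
  finally show ?thesis .
qed

lemma degree_touchard_prod: "degree (\<Prod>j = 1..m. touchard j ^ r j) = num_vertices m r"
  by (simp add: degree_prod_eq_sum_degree degree_power_eq num_vertices_def mult.commute)

section \<open>The reversed product and its exponential factor\<close>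

definition reversed_touchard_prod :: "nat \<Rightarrow> (nat \<Rightarrow> nat) \<Rightarrow> real fps" where
  "reversed_touchard_prod m r = (\<Prod>j = 1..m. reversed_touchard j ^ r j)"

lemma reversed_touchard_prod_eq:
  "reversed_touchard_prod m r = fps_of_poly (reflect_poly (\<Prod>j = 1..m. touchard j ^ r j))"
  by (simp add: reversed_touchard_prod_def reversed_touchard_def reflect_poly_prod reflect_poly_power
      fps_of_poly_prod fps_of_poly_power)

lemma num_acyclic_eq_sum:
  "real (num_acyclic m r) =
     (\<Sum>k\<le>num_vertices m r. reversed_touchard_prod m r $ k * fact (num_vertices m r - k))"
proof -
  let ?P = "\<Prod>j = 1..m. touchard j ^ r j" and ?N = "num_vertices m r"
  have "real (num_acyclic m r) = (\<Sum>k\<le>?N. coeff ?P k * fact k)"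
    unfolding num_acyclic_eq_laplace_one laplace_one_def degree_touchard_prod ..
  also have "\<dots> = (\<Sum>k\<le>?N. coeff ?P (?N - k) * fact (?N - k))"
    by (rule sum.reindex_bij_witness[of _ "\<lambda>k. ?N - k" "\<lambda>k. ?N - k"]) auto
  also have "\<dots> = (\<Sum>k\<le>?N. reversed_touchard_prod m r $ k * fact (?N - k))"
    by (intro sum.cong) (auto simp: reversed_touchard_prod_eq coeff_reflect_poly degree_touchard_prod[unfolded One_nat_def])
  finally show ?thesis .
qed

text \<open>Each \<open>touchard j\<close> with \<open>j \<ge> 1\<close> is divisible by the variable, so the product has no term of degree
  below the number of parts, which is at least \<open>N / m\<close>.\<close>

lemma reversed_touchard_prod_nth_eq_0:
  assumes "num_vertices m r > m * (num_vertices m r - k)"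
  shows "reversed_touchard_prod m r $ k = 0"
proof -
  have d: "degree (reflect_poly (touchard j)) \<le> j - 1" for j
    by (rule degree_le) (use reversed_touchard_nth_ge[of j] in \<open>auto simp: reversed_touchard_def\<close>)
  have "degree (reflect_poly (\<Prod>j = 1..m. touchard j ^ r j)) \<le> (\<Sum>j = 1..m. degree (reflect_poly (touchard j) ^ r j))"
    unfolding reflect_poly_prod reflect_poly_power using degree_prod_sum_le[of "{1..m}"] by auto
  also have "\<dots> \<le> (\<Sum>j = 1..m. (j - 1) * r j)"
    by (intro sum_mono order.trans[OF degree_power_le] mult_le_mono1 d)
  also have "\<dots> < k"
  proof -
    \<comment> \<open>The degree bound is \<open>N\<close> minus the number of parts; the assumption
      makes the number of parts exceed \<open>N - k\<close>.\<close>
    have *: "(\<Sum>j = 1..m. (j - 1) * r j) + (\<Sum>j = 1..m. r j) = num_vertices m r"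
      unfolding num_vertices_def sum.distrib[symmetric]
      by (intro sum.cong refl) (auto simp: algebra_simps diff_mult_distrib)
    have "num_vertices m r \<le> m * (\<Sum>j = 1..m. r j)"
      unfolding num_vertices_def sum_distrib_left by (intro sum_mono mult_le_mono1) auto
    then have "m * (num_vertices m r - k) < m * (\<Sum>j = 1..m. r j)" using assms by linarith
    then show ?thesis using * by auto
  qed
  finally show ?thesis by (simp add: reversed_touchard_prod_eq coeff_eq_0)
qed

text \<open>The exponential cancels the linear coefficient; the factors removed from all parts
  together form exp (N \<mu>1 y).\<close>

definition centred_touchard :: "nat \<Rightarrow> real fps" where
  "centred_touchard j = reversed_touchard j * fps_exp (- coef_A j)"

text \<open>The quadratic coefficient is B - A^2 + A^2 / 2, which explains
  \<open>coef_E\<close>.\<close>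

lemma centred_touchard_nth:
  "centred_touchard j $ 0 = 1" "centred_touchard j $ 1 = 0" "centred_touchard j $ 2 = coef_E j"
proof -
  show "centred_touchard j $ 0 = 1" by (simp add: centred_touchard_def)
  show "centred_touchard j $ 1 = 0"
    unfolding centred_touchard_def fps_mult_nth_1 using reversed_touchard_nth_1[of j] by simp
  have "centred_touchard j $ 2 = reversed_touchard j $ 0 * fps_exp (- coef_A j) $ 2 +
     reversed_touchard j $ 1 * fps_exp (- coef_A j) $ 1 + reversed_touchard j $ 2 * fps_exp (- coef_A j) $ 0"
    unfolding centred_touchard_def by (simp add: fps_mult_nth numeral_2_eq_2)
  then show "centred_touchard j $ 2 = coef_E j"
    unfolding reversed_touchard_nth_1 reversed_touchard_nth_2
    by (simp add: coef_E_def power2_eq_square)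
qed

text \<open>Both factors are majorised by \<open>fps_exp (- coef_A j)\<close>, and
  \<open>- 2 * coef_A j = j * (j - 1)\<close> is at most \<open>m^2\<close>. Degrees 0 and 1 are
  compared exactly, so the majorant can omit its linear term.\<close>

lemma centred_touchard_dominated:
  assumes "j \<le> m"
  shows "fps_dominated (centred_touchard j) (1 + tail_exp (real m ^ 2))"
  unfolding fps_dominated_def
proof
  fix k :: nat
  have A: "0 \<le> - coef_A j" "- 2 * coef_A j \<le> real m ^ 2"
  proof -
    show "0 \<le> - coef_A j" by (cases j) (auto simp: coef_A_def)
    have "- 2 * coef_A j = real j * (real j - 1)" by (simp add: coef_A_def)
    also have "\<dots> \<le> real m * real m" using assms by (cases j) (auto intro!: mult_mono)
    finally show "- 2 * coef_A j \<le> real m ^ 2" by (simp add: power2_eq_square)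
  qed
  consider "k = 0" | "k = 1" | "k \<ge> 2" by linarith
  then show "\<bar>centred_touchard j $ k\<bar> \<le> (1 + tail_exp (real m ^ 2)) $ k"
  proof cases
    case 3
    have "fps_dominated (fps_exp (- coef_A j)) (fps_exp (- coef_A j))"
      using A(1) by (simp add: fps_dominated_def fps_exp_nth power_abs)
    then have "fps_dominated (centred_touchard j) (fps_exp (- coef_A j) * fps_exp (- coef_A j))"
      unfolding centred_touchard_def by (intro fps_dominated_mult reversed_touchard_dominated)
    then have "fps_dominated (centred_touchard j) (fps_exp (- 2 * coef_A j))"
      by (simp flip: fps_exp_add_mult)
    from fps_dominatedD[OF this, of k]
    have "\<bar>centred_touchard j $ k\<bar> \<le> (- 2 * coef_A j) ^ k / fact k" by (simp add: fps_exp_nth)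
    also have "\<dots> \<le> (real m ^ 2) ^ k / fact k"
      using A by (intro divide_right_mono power_mono) auto
    finally show ?thesis using 3 by (simp add: tail_exp_def)
  qed (use centred_touchard_nth in \<open>auto simp: tail_exp_def\<close>)
qed

definition centred_touchard_prod :: "nat \<Rightarrow> (nat \<Rightarrow> nat) \<Rightarrow> real fps" where
  "centred_touchard_prod m r = (\<Prod>j = 1..m. centred_touchard j ^ r j)"

lemma centred_touchard_prod_nth:
  "centred_touchard_prod m r $ 0 = 1" "centred_touchard_prod m r $ 1 = 0"
  "centred_touchard_prod m r $ 2 = (\<Sum>j = 1..m. real (r j) * coef_E j)"
proof -
  have p: "(centred_touchard j ^ n) $ 0 = 1 \<and> (centred_touchard j ^ n) $ 1 = 0 \<and>
     (centred_touchard j ^ n) $ 2 = real n * coef_E j" for j n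
    using prod_unit_quadratic_nth[of "{..<n}" "\<lambda>_. centred_touchard j"] centred_touchard_nth[of j] by simp
  show "centred_touchard_prod m r $ 0 = 1" "centred_touchard_prod m r $ 1 = 0"
    "centred_touchard_prod m r $ 2 = (\<Sum>j = 1..m. real (r j) * coef_E j)"
    using prod_unit_quadratic_nth[of "{1..m}" "\<lambda>j. centred_touchard j ^ r j"] p
    unfolding centred_touchard_prod_def by simp_all
qed

lemma centred_touchard_prod_nth_le:
  assumes "num_vertices m r > 0" "i \<ge> 3"
  shows "\<bar>centred_touchard_prod m r $ i\<bar> \<le> real (num_vertices m r) ^ (i - 2) * tail_majorant (real m ^ 2) i"
proof -
  have "fps_dominated (centred_touchard_prod m r) (\<Prod>j = 1..m. (1 + tail_exp (real m ^ 2)) ^ r j)"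
    unfolding centred_touchard_prod_def
    by (intro fps_dominated_prod fps_dominated_power centred_touchard_dominated) auto
  also have "(\<Prod>j = 1..m. (1 + tail_exp (real m ^ 2)) ^ r j) = (1 + tail_exp (real m ^ 2)) ^ (\<Sum>j = 1..m. r j)"
    by (rule power_sum[symmetric])
  finally have "\<bar>centred_touchard_prod m r $ i\<bar> \<le> ((1 + tail_exp (real m ^ 2)) ^ (\<Sum>j = 1..m. r j)) $ i"
    by (rule fps_dominatedD)
  also have "(\<Sum>j = 1..m. r j) \<le> num_vertices m r"
    unfolding num_vertices_def by (intro sum_mono) auto
  then have "((1 + tail_exp (real m ^ 2)) ^ (\<Sum>j = 1..m. r j)) $ i
      \<le> real (num_vertices m r) ^ (i - 2) * tail_majorant (real m ^ 2) i"
    using assms by (intro one_plus_tail_exp_power_nth_le) auto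
  finally show ?thesis .
qed

lemma reversed_touchard_prod_factor:
  "reversed_touchard_prod m r = centred_touchard_prod m r * fps_exp (\<Sum>j = 1..m. real (r j) * coef_A j)"
proof -
  have "fps_exp (- c) * fps_exp c = 1" for c :: real
    by (simp flip: fps_exp_add_mult)
  then have "reversed_touchard j = centred_touchard j * fps_exp (coef_A j)" for j
    by (simp add: centred_touchard_def mult.assoc)
  then show ?thesis
    unfolding reversed_touchard_prod_def centred_touchard_prod_def fps_exp_sum
    by (simp add: power_mult_distrib prod.distrib fps_exp_power_mult)
qed

text \<open>Replacing y by y / N moves \<open>N ^ k\<close> into the weights and leaves exp (\<mu>1
  y). The cutoff parameter is \<open>m + 1\<close> because the weight estimates require at least 2,
  while \<open>m\<close> may be 1.\<close>

lemma num_acyclic_weighted_sums: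
  fixes m r
  defines "N \<equiv> num_vertices m r"
  assumes "N > 0"
  shows "(\<lambda>k. exp_convolution (\<lambda>i. centred_touchard_prod m r $ i / real N ^ i) (mu1 m r) k *
      weight (m + 1) N k) sums (real (num_acyclic m r) / fact N)"
proof -
  define b where "b = exp_convolution (\<lambda>i. centred_touchard_prod m r $ i / real N ^ i) (mu1 m r)"
  have \<mu>: "(\<Sum>j = 1..m. real (r j) * coef_A j) = real N * mu1 m r"
    using assms by (simp add: mu1_def)
  have b: "reversed_touchard_prod m r $ k = real N ^ k * b k" for k
  proof -
    have "reversed_touchard_prod m r $ k =
        (\<Sum>i\<le>k. centred_touchard_prod m r $ i * ((real N * mu1 m r) ^ (k - i) / fact (k - i)))"
      unfolding reversed_touchard_prod_factor fps_mult_nth \<mu> by (simp add: fps_exp_nth atLeast0AtMost)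
    also have "\<dots> = real N ^ k * b k"
      unfolding b_def exp_convolution_def sum_distrib_left
    proof (rule sum.cong[OF refl])
      fix i assume "i \<in> {..k}"
      then have "real N ^ k = real N ^ i * real N ^ (k - i)" by (simp flip: power_add)
      then show "centred_touchard_prod m r $ i * ((real N * mu1 m r) ^ (k - i) / fact (k - i)) =
          real N ^ k * (centred_touchard_prod m r $ i / real N ^ i * (mu1 m r ^ (k - i) / fact (k - i)))"
        using assms(2) by (simp add: power_mult_distrib)
    qed
    finally show ?thesis .
  qed
  have "b k * weight (m + 1) N k = reversed_touchard_prod m r $ k * fact (N - k) / fact N" if "k \<le> N" for k
  proof (cases "N \<le> (m + 1) * (N - k)")
    case True
    then show ?thesis using that by (simp add: b weight_def falling_ratio_def)
  next
    case False
    \<comment> \<open>Failing the cutoff for \<open>m + 1\<close> implies failing it for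
      \<open>m\<close>.\<close>
    then have "reversed_touchard_prod m r $ k = 0"
      unfolding N_def by (intro reversed_touchard_prod_nth_eq_0) simp
    then show ?thesis using False by (simp add: weight_def)
  qed
  then have "(\<Sum>k\<le>N. b k * weight (m + 1) N k) = real (num_acyclic m r) / fact N"
    by (simp add: num_acyclic_eq_sum N_def sum_divide_distrib)
  moreover have "(\<lambda>k. b k * weight (m + 1) N k) sums (\<Sum>k\<le>N. b k * weight (m + 1) N k)"
    by (rule sums_finite) (auto simp: weight_def)
  ultimately show ?thesis by (simp add: b_def)
qed

section \<open>Bounds uniform in \<open>r\<close> and the final estimate\<close>

lemma mu1_abs_le:
  assumes "num_vertices m r > 0"
  shows "\<bar>mu1 m r\<bar> \<le> real m"
proof -
  have "\<bar>\<Sum>j = 1..m. real (r j) * coef_A j\<bar> \<le> (\<Sum>j = 1..m. real m * real (j * r j))"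
  proof (rule order.trans[OF sum_abs], rule sum_mono)
    fix j assume j: "j \<in> {1..m}"
    then have "\<bar>coef_A j\<bar> = real j * (real j - 1) / 2" by (simp add: coef_A_def)
    also have "\<dots> \<le> real j * (real j - 1)" using j by simp
    also have "\<dots> \<le> real j * real m" using j by (intro mult_left_mono) auto
    finally have "real (r j) * \<bar>coef_A j\<bar> \<le> real (r j) * (real j * real m)" by (intro mult_left_mono) auto
    then show "\<bar>real (r j) * coef_A j\<bar> \<le> real m * real (j * r j)" by (simp add: abs_mult mult_ac)
  qed
  also have "\<dots> = real m * real (num_vertices m r)"
    by (simp add: num_vertices_def sum_distrib_left)
  finally show ?thesis using assms by (simp add: mu1_def abs_mult divide_le_eq)
qed

lemma mu2_abs_le:
  assumes "num_vertices m r > 0"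
  shows "\<bar>mu2 m r\<bar> \<le> (\<Sum>j = 1..m. \<bar>coef_E j\<bar>)"
proof -
  let ?L = "\<Sum>j = 1..m. \<bar>coef_E j\<bar>"
  have "\<bar>\<Sum>j = 1..m. real (r j) * coef_E j\<bar> \<le> (\<Sum>j = 1..m. real (j * r j) * ?L)"
  proof (rule order.trans[OF sum_abs], rule sum_mono)
    fix j assume j: "j \<in> {1..m}"
    then have "\<bar>coef_E j\<bar> \<le> ?L" by (intro member_le_sum) auto
    moreover have "real (r j) \<le> real (j * r j)" unfolding of_nat_le_iff using j by simp
    ultimately show "\<bar>real (r j) * coef_E j\<bar> \<le> real (j * r j) * ?L"
      unfolding abs_mult by (intro mult_mono) auto
  qed
  also have "\<dots> = ?L * real (num_vertices m r)"
    unfolding num_vertices_def of_nat_sum sum_distrib_right[symmetric] by (rule mult.commute)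
  finally show ?thesis using assms by (simp add: mu2_def abs_mult divide_le_eq)
qed

theorem theorem7:
  fixes m :: nat
  assumes "m \<ge> 1"
  shows "\<exists>(C :: real) (N0 :: nat). \<forall>r :: nat \<Rightarrow> nat. num_vertices m r \<ge> N0 \<longrightarrow>
           (\<exists>err :: real. \<bar>err\<bar> \<le> C / (real (num_vertices m r))\<^sup>2 \<and>
             real (num_acyclic m r) =
               exp (mu1 m r) * fact (num_vertices m r) *
               (1 + (mu2 m r + (mu1 m r)\<^sup>2 / 2) / real (num_vertices m r) + err))"
proof -
  \<comment> \<open>None of \<open>h\<close>, \<open>L\<close> and \<open>C\<close> involves
    \<open>r\<close>; this is the source of uniformity.\<close>
  define h where "h = tail_majorant (real m ^ 2)"
  define L where "L = (\<Sum>j = 1..m. \<bar>coef_E j\<bar>)"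
  define C where "C = (\<Sum>k. error_term (m + 1) (real m) L h k)"
  have h: "h i \<ge> 0" "summable (\<lambda>i. h i * real (m + 1) ^ i)" for i
    unfolding h_def by (auto intro!: tail_majorant_nonneg summable_tail_majorant)
  have main: "\<exists>err. \<bar>err\<bar> \<le> exp (real m) * C / (real (num_vertices m r))\<^sup>2 \<and>
      real (num_acyclic m r) = exp (mu1 m r) * fact (num_vertices m r) *
        (1 + (mu2 m r + (mu1 m r)\<^sup>2 / 2) / real (num_vertices m r) + err)"
    if N: "num_vertices m r \<ge> 1" for r
  proof -
    define N where "N = num_vertices m r"
    define S where "S = real (num_acyclic m r) / fact N"
    define X where "X = 1 + (mu2 m r + (mu1 m r)\<^sup>2 / 2) / real N"
    define \<gamma> where "\<gamma> i = centred_touchard_prod m r $ i / real N ^ i" for i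
    have N0: "N > 0" using that by (simp add: N_def)
    have "\<bar>S - exp (mu1 m r) * X\<bar> \<le> C / real N ^ 2"
      unfolding X_def C_def
    proof (rule weighted_sum_expansion[where \<gamma> = \<gamma>])
      show "\<gamma> 0 = 1" "\<gamma> 1 = 0"
        using centred_touchard_prod_nth(1,2)[of m r] by (simp_all add: \<gamma>_def)
      show "\<gamma> 2 = mu2 m r / real N"
        using N0 by (simp add: \<gamma>_def centred_touchard_prod_nth mu2_def N_def power2_eq_square)
      show "\<bar>\<gamma> i\<bar> \<le> h i / real N ^ 2" if "i \<ge> 3" for i
      proof -
        have "2 + (i - 2) = i" using that by simp
        then have "real N ^ i = real N ^ 2 * real N ^ (i - 2)" by (metis power_add)
        then show ?thesis
          using centred_touchard_prod_nth_le[of m r i] that N0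
          by (simp add: \<gamma>_def h_def N_def divide_le_eq mult_ac)
      qed
      show "(\<lambda>k. exp_convolution \<gamma> (mu1 m r) k * weight (m + 1) N k) sums S"
        using num_acyclic_weighted_sums[of m r] N0 by (simp add: \<gamma>_def[abs_def] S_def N_def)
    qed (use assms h N0 mu1_abs_le mu2_abs_le in \<open>simp_all add: N_def L_def\<close>)
    moreover define err where "err = S / exp (mu1 m r) - X"
    then have "S - exp (mu1 m r) * X = exp (mu1 m r) * err" by (simp add: right_diff_distrib)
    ultimately have E: "exp (mu1 m r) * \<bar>err\<bar> \<le> C / real N ^ 2" by (simp only: abs_mult abs_exp_cancel)
    \<comment> \<open>Extracting \<open>exp (mu1 m r)\<close> makes the error relative; this factor
      is at least exp (-m), so the constant grows by at most \<open>exp (real m)\<close>.\<close>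
    have "0 \<le> real m + mu1 m r" using mu1_abs_le[of m r] N0 unfolding N_def by linarith
    then have "1 \<le> exp (real m) * exp (mu1 m r)" unfolding exp_add[symmetric] by simp
    then have "1 * \<bar>err\<bar> \<le> (exp (real m) * exp (mu1 m r)) * \<bar>err\<bar>"
      by (rule mult_right_mono) simp
    also have "\<dots> \<le> exp (real m) * (C / real N ^ 2)"
      unfolding mult.assoc by (rule mult_left_mono[OF E]) simp
    finally have "\<bar>err\<bar> \<le> exp (real m) * (C / real N ^ 2)" by simp
    moreover have "real (num_acyclic m r) = exp (mu1 m r) * fact N * (X + err)"
    proof -
      have "X + err = S / exp (mu1 m r)" unfolding err_def by simp
      moreover have "real (num_acyclic m r) = S * fact N" unfolding S_def by simp
      ultimately show ?thesis by simp
    qed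
    ultimately show ?thesis unfolding X_def N_def by (intro exI[of _ err] conjI) (simp_all only: times_divide_eq_right)
  qed
  show ?thesis
    by (rule exI[of _ "exp (real m) * C"], rule exI[of _ 1], intro allI impI, rule main)
qed

end
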